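(* Let $W$ be the additive white Gaussian noise channel with unit noise variance, i.e.\ $W(y|x)=\frac{1}{\sqrt{2\pi}}\exp\big(-\frac{(y-x)^2}{2}\big)$ for $x,y\in\mathbb{R}$, and let $M^*(W^n,\varepsilon,P)$ be the largest $M\in\mathbb{N}$ for which an $(n,M,\varepsilon,P)_{\mathrm{av}}$-code exists. For all $0<\varepsilon<1$ and $P\in(0,\infty)$, there is a constant $c$ (depending on $\varepsilon$ and $P$ but not on $n$) such that for all $n$, \[ \log M^*(W^n,\varepsilon,P) \ge n\,\mathsf{C}(P)+\sqrt{n\,\mathsf{V}(P)}\,\Phi^{-1}(\varepsilon)+\frac{1}{2}\log n + c, \] i.e.\ $\log M^*(W^n,\varepsilon,P) \ge n\mathsf{C}(P)+\sqrt{n\mathsf{V}(P)}\Phi^{-1}(\varepsilon)+\frac12\log n+O(1)$.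
   Context: Let $W^n(\mathbf{y}|\mathbf{x})=\prod_{i=1}^n W(y_i|x_i)$ for $\mathbf{x},\mathbf{y}\in\mathbb{R}^n$. An $(n,M,\varepsilon,P)_{\mathrm{av}}$-code is a collection $\{(\mathbf{x}(m),\mathcal{D}_m)\}_{m=1}^M$ of codewords $\mathbf{x}(m)\in\mathbb{R}^n$ satisfying the maximal power constraint $\|\mathbf{x}(m)\|_2^2\le nP$ for every $m$, and pairwise disjoint (measurable) decoding regions $\mathcal{D}_m\subset\mathbb{R}^n$, such that the average error probability satisfies $\frac{1}{M}\sum_{m=1}^M W^n(\mathcal{D}_m^c\,|\,\mathbf{x}(m))\le\varepsilon$. The capacity and dispersion functions are $\mathsf{C}(P)=\frac12\log(1+P)$ and $\mathsf{V}(P)=\log^2\mathrm{e}\cdot\frac{P(P+2)}{2(P+1)^2}$ (with logarithms to a common fixed base throughout). $\Phi$ is the standard Gaussian cumulative distribution function and $\Phi^{-1}$ its inverse. *)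

theory Defs
  imports "HOL-Probability.Probability"
begin

definition W_awgn :: "real \<Rightarrow> real \<Rightarrow> real" where
  "W_awgn y x = 1 / sqrt (2 * pi) * exp (- ((y - x)^2) / 2)"

text \<open>Vectors in R^n are represented as functions nat => real, only indices i < n matter.
  The output space R^n is the product measure space over {..<n}.\<close>
definition out_space :: "nat \<Rightarrow> (nat \<Rightarrow> real) measure" where
  "out_space n = PiM {..<n} (\<lambda>_. lborel)"

definition Wn :: "nat \<Rightarrow> (nat \<Rightarrow> real) \<Rightarrow> (nat \<Rightarrow> real) measure" where
  "Wn n x = PiM {..<n} (\<lambda>i. density lborel (\<lambda>y. ennreal (W_awgn y (x i))))"

definition is_av_code ::
  "nat \<Rightarrow> nat \<Rightarrow> real \<Rightarrow> real \<Rightarrow> (nat \<Rightarrow> nat \<Rightarrow> real) \<Rightarrow> (nat \<Rightarrow> (nat \<Rightarrow> real) set) \<Rightarrow> bool"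
  where
  "is_av_code n M eps P x D \<longleftrightarrow>
     (\<forall>m\<in>{1..M}. (\<Sum>i<n. (x m i)^2) \<le> real n * P) \<and>
     (\<forall>m\<in>{1..M}. D m \<in> sets (out_space n)) \<and>
     (\<forall>m\<in>{1..M}. \<forall>m'\<in>{1..M}. m \<noteq> m' \<longrightarrow> D m \<inter> D m' = {}) \<and>
     (1 / real M) * (\<Sum>m=1..M. measure (Wn n (x m)) (space (out_space n) - D m)) \<le> eps"

definition Mstar :: "nat \<Rightarrow> real \<Rightarrow> real \<Rightarrow> nat" where
  "Mstar n eps P = (GREATEST M. \<exists>x D. is_av_code n M eps P x D)"

definition cap :: "real \<Rightarrow> real \<Rightarrow> real" where
  "cap b P = 1/2 * log b (1 + P)"

definition disp :: "real \<Rightarrow> real \<Rightarrow> real" where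
  "disp b P = (log b (exp 1))^2 * (P * (P + 2)) / (2 * (P + 1)^2)"

definition Phi :: "real \<Rightarrow> real" where
  "Phi t = (LBINT s=-\<infinity>..ereal t. 1 / sqrt (2 * pi) * exp (- (s^2) / 2))"

definition Phi_inv :: "real \<Rightarrow> real" where
  "Phi_inv p = (THE t. Phi t = p)"

end

theory Submission
  imports Defs "HOL-Real_Asymp.Real_Asymp"
begin

text \<open>
  Random codewords are drawn uniformly from the sphere of radius \<open>A = sqrt (n P)\<close> (as normalized
  Gaussian vectors) and decoded by maximal inner product with the output. By rotation invariance the
  noise seen from the transmitted codeword is a pair \<open>(x, y)\<close> of independent variables, \<open>x\<close>
  standard normal and \<open>y\<close> chi distributed with \<open>n - 1\<close> degrees of freedom, and an independent
  codeword scores at least as well with probability at most \<open>B ((A + x) / y)\<close>, where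
  \<open>B v = Pr (v r \<le> a)\<close> for a fresh such pair \<open>(a, r)\<close>. Hence the random coding union bound gives, for
  every threshold \<open>w\<close>, an error probability of at most
  \<open>Pr (A + x \<le> w y) + M E (B ((A + x) / y); A + x > w y)\<close>.
  The second expectation is of order \<open>(1 + w\<^sup>2) powr (- n / 2) / n\<close>: one factor \<open>1 / sqrt n\<close> comes
  from the Gaussian tail in \<open>B\<close>, the other from the bounded density of \<open>x\<close>. Therefore
  \<open>M = sqrt n (1 + w\<^sup>2) powr (n / 2)\<close> costs only \<open>O (1 / sqrt n)\<close> in error, which is the source
  of the term \<open>ln n / 2\<close>. The chi law is within \<open>O (1 / sqrt n)\<close> in total variation of a normal law of
  variance \<open>1 / 2\<close>, so the first probability is
  \<open>\<Phi> ((w - sqrt P) sqrt n / sqrt (1 + w\<^sup>2 / 2)) + O (1 / sqrt n)\<close>, and it remains to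
  choose \<open>w - sqrt P\<close> of order \<open>1 / sqrt n\<close>.
\<close>

section \<open>Integrals and product measures\<close>

lemma borel_measurable_pred_le[measurable (raw)]:
  fixes f :: "'a \<Rightarrow> 'b::{second_countable_topology, linorder_topology}"
  shows "f \<in> borel_measurable M \<Longrightarrow> g \<in> borel_measurable M \<Longrightarrow> Measurable.pred M (\<lambda>w. f w \<le> g w)"
  unfolding Measurable.pred_def by (rule borel_measurable_le)

lemma (in prob_space) nn_integral_le_obtains:
  assumes [measurable]: "f \<in> borel_measurable M" and integral_le: "(\<integral>\<^sup>+x. f x \<partial>M) \<le> ennreal c"
  obtains x where "x \<in> space M" "f x \<le> ennreal c"
proof (rule ccontr)
  assume "\<not> thesis"
  with that have all_greater: "ennreal c < f x" if "x \<in> space M" for x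
    using \<open>x \<in> space M\<close> by (auto simp: not_le[symmetric])
  have "\<not> (AE x in M. f x \<le> ennreal c)"
  proof
    assume "AE x in M. f x \<le> ennreal c"
    then have "AE x in M. False" using AE_space by eventually_elim (use all_greater in force)
    then show False by simp
  qed
  then have "(\<integral>\<^sup>+x. ennreal c \<partial>M) < (\<integral>\<^sup>+x. f x \<partial>M)"
    using all_greater by (intro nn_integral_less) (auto simp: emeasure_space_1 less_imp_le)
  then show False using integral_le by (simp add: emeasure_space_1)
qed

lemma integral_mult_le_of_density_gap:
  fixes f g e h :: "'a \<Rightarrow> real"
  assumes f_int: "integrable M f" and g_int: "integrable M g" and e_int: "integrable M e"
    and mass: "(\<integral>x. f x \<partial>M) = (\<integral>x. g x \<partial>M)"
    and gap: "\<And>x. g x - f x \<le> e x" and e_nonneg: "\<And>x. 0 \<le> e x"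
    and h_range: "h \<in> borel_measurable M" "\<And>x. 0 \<le> h x" "\<And>x. h x \<le> 1"
  shows "(\<integral>x. f x * h x \<partial>M) \<le> (\<integral>x. g x * h x \<partial>M) + (\<integral>x. e x \<partial>M)"
proof -
  have mult_int: "integrable M (\<lambda>x. k x * h x)" if "integrable M k" for k :: "'a \<Rightarrow> real"
    using that h_range
    by (intro Bochner_Integration.integrable_bound[OF that]) (auto simp: abs_mult mult_left_le)
  have "(\<integral>x. (g x - g x * h x) - (f x - f x * h x) \<partial>M) \<le> (\<integral>x. e x \<partial>M)"
  proof (rule integral_mono)
    show "integrable M (\<lambda>x. (g x - g x * h x) - (f x - f x * h x))"
      by (intro Bochner_Integration.integrable_diff
        mult_int f_int g_int)
    fix x
    have "(g x - f x) * (1 - h x) \<le> e x * (1 - h x)"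
      using gap[of x] h_range(3)[of x] by (intro mult_right_mono) auto
    also have "\<dots> \<le> e x" using e_nonneg[of x] h_range(2)[of x] h_range(3)[of x] by (intro mult_left_le) auto
    finally show "(g x - g x * h x) - (f x - f x * h x) \<le> e x" by (simp add: algebra_simps)
  qed (rule e_int)
  then show ?thesis
    using mass by (simp add: Bochner_Integration.integral_diff Bochner_Integration.integrable_diff
        mult_int f_int g_int)
qed

lemma nn_integral_PiM_component:
  assumes prob_Q: "prob_space Q" and "m \<in> I" and [measurable]: "f \<in> borel_measurable Q"
  shows "(\<integral>\<^sup>+G. f (G m) \<partial>PiM I (\<lambda>_. Q)) = (\<integral>\<^sup>+x. f x \<partial>Q)"
proof -
  have "(\<integral>\<^sup>+x. f x \<partial>Q) = (\<integral>\<^sup>+x. f x \<partial>distr (PiM I (\<lambda>_. Q)) Q (\<lambda>G. G m))"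
    using distr_PiM_component[of I "\<lambda>_. Q" m] assms by simp
  also have "\<dots> = (\<integral>\<^sup>+G. f (G m) \<partial>PiM I (\<lambda>_. Q))"
    using assms by (intro nn_integral_distr) auto
  finally show ?thesis by simp
qed

lemma PiM_distr:
  assumes fin: "finite I"
    and prob_M: "\<And>i. prob_space (M i)" and f_measurable[measurable]: "\<And>i. f i \<in> M i \<rightarrow>\<^sub>M N i"
  shows "PiM I (\<lambda>i. distr (M i) (N i) (f i)) = distr (PiM I M) (PiM I N) (\<lambda>x. \<lambda>i\<in>I. f i (x i))"
proof -
  interpret M: product_prob_space M by (intro product_prob_spaceI prob_M)
  interpret D: product_prob_space "\<lambda>i. distr (M i) (N i) (f i)"
    by (intro product_prob_spaceI prob_space.prob_space_distr prob_M f_measurable)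
  let ?F = "\<lambda>x. \<lambda>i\<in>I. f i (x i)"
  show ?thesis
  proof (rule D.PiM_eqI[symmetric])
    show "sets (distr (PiM I M) (PiM I N) ?F) = sets (PiM I (\<lambda>i. distr (M i) (N i) (f i)))"
      by (simp, intro sets_PiM_cong) auto
    fix A assume "\<And>i. i \<in> I \<Longrightarrow> A i \<in> sets (distr (M i) (N i) (f i))"
    then have A_sets: "A i \<in> sets (N i)" if "i \<in> I" for i using that by simp
    have "emeasure (distr (PiM I M) (PiM I N) ?F) (Pi\<^sub>E I A)
        = emeasure (PiM I M) (?F -` Pi\<^sub>E I A \<inter> space (PiM I M))"
      using A_sets fin by (intro emeasure_distr sets_PiM_I_finite) measurable
    also have "?F -` Pi\<^sub>E I A \<inter> space (PiM I M) = Pi\<^sub>E I (\<lambda>i. f i -` A i \<inter> space (M i))"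
      by (auto simp: space_PiM PiE_iff restrict_PiE_iff)
    also have "emeasure (PiM I M) \<dots> = (\<Prod>i\<in>I. emeasure (M i) (f i -` A i \<inter> space (M i)))"
      using A_sets fin by (intro M.emeasure_PiM) (auto intro: measurable_sets[OF f_measurable])
    also have "\<dots> = (\<Prod>i\<in>I. emeasure (distr (M i) (N i) (f i)) (A i))"
      using A_sets by (intro prod.cong refl emeasure_distr[symmetric]) auto
    finally show "emeasure (distr (PiM I M) (PiM I N) ?F) (Pi\<^sub>E I A)
      = (\<Prod>i\<in>I. emeasure (distr (M i) (N i) (f i)) (A i))" .
  qed (rule fin)
qed

lemma indicator_PiE_eq_prod:
  fixes A :: "'i \<Rightarrow> 'a set"
  assumes "finite I" "x \<in> extensional I"
  shows "(indicator (Pi\<^sub>E I A) x :: ennreal) = (\<Prod>i\<in>I. indicator (A i) (x i))"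
proof (cases "\<forall>i\<in>I. x i \<in> A i")
  case True
  then show ?thesis using assms(2) by (simp add: PiE_iff)
next
  case False
  then obtain i where i: "i \<in> I" "x i \<notin> A i" by blast
  then have "(\<Prod>i\<in>I. indicator (A i) (x i) :: ennreal) = 0"
    using assms(1) by (intro prod_zero) (auto intro!: bexI[of _ i])
  moreover have "x \<notin> Pi\<^sub>E I A" using i by (auto simp: PiE_iff)
  ultimately show ?thesis by simp
qed

lemma PiM_density:
  fixes f :: "'i \<Rightarrow> 'a \<Rightarrow> ennreal"
  assumes "finite I" "\<And>i. sigma_finite_measure (N i)" "\<And>i. sigma_finite_measure (density (N i) (f i))"
    and [measurable]: "\<And>i. f i \<in> borel_measurable (N i)"
  shows "PiM I (\<lambda>i. density (N i) (f i)) = density (PiM I N) (\<lambda>x. \<Prod>i\<in>I. f i (x i))"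
proof -
  interpret D: product_sigma_finite "\<lambda>i. density (N i) (f i)" by (rule product_sigma_finite.intro) fact
  interpret N: product_sigma_finite N by (rule product_sigma_finite.intro) fact
  show ?thesis
  proof (rule D.PiM_eqI[symmetric])
    show "finite I" by fact
    show "sets (density (PiM I N) (\<lambda>x. \<Prod>i\<in>I. f i (x i))) = sets (PiM I (\<lambda>i. density (N i) (f i)))"
      by (simp, intro sets_PiM_cong) auto
    fix A assume A_sets: "\<And>i. i \<in> I \<Longrightarrow> A i \<in> sets (density (N i) (f i))"
    have "Pi\<^sub>E I A \<in> sets (PiM I N)" using A_sets \<open>finite I\<close> by (intro sets_PiM_I_finite) auto
    moreover have "(\<lambda>x. \<Prod>i\<in>I. f i (x i)) \<in> borel_measurable (PiM I N)" by measurable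
    ultimately have "emeasure (density (PiM I N) (\<lambda>x. \<Prod>i\<in>I. f i (x i))) (Pi\<^sub>E I A)
      = (\<integral>\<^sup>+x. (\<Prod>i\<in>I. f i (x i)) * indicator (Pi\<^sub>E I A) x \<partial>PiM I N)"
      by (intro emeasure_density)
    also have "\<dots> = (\<integral>\<^sup>+x. (\<Prod>i\<in>I. f i (x i) * indicator (A i) (x i)) \<partial>PiM I N)"
      using \<open>finite I\<close>
      by (intro nn_integral_cong) (simp add: indicator_PiE_eq_prod prod.distrib space_PiM PiE_iff)
    also have "\<dots> = (\<Prod>i\<in>I. \<integral>\<^sup>+x. f i x * indicator (A i) x \<partial>N i)"
      using \<open>finite I\<close> A_sets by (intro N.product_nn_integral_prod) auto
    also have "\<dots> = (\<Prod>i\<in>I. emeasure (density (N i) (f i)) (A i))"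
      using A_sets by (intro prod.cong refl emeasure_density[symmetric]) auto
    finally show "emeasure (density (PiM I N) (\<lambda>x. \<Prod>i\<in>I. f i (x i))) (Pi\<^sub>E I A)
      = (\<Prod>i\<in>I. emeasure (density (N i) (f i)) (A i))" .
  qed
qed

section \<open>Rotation invariance of the Gaussian measure\<close>

lemma sum_power2_rotation:
  fixes p q a b :: real
  assumes "p\<^sup>2 + q\<^sup>2 = 1"
  shows "(p * a + q * b)\<^sup>2 + (p * b - q * a)\<^sup>2 = a\<^sup>2 + b\<^sup>2"
proof -
  have "(p * a + q * b)\<^sup>2 + (p * b - q * a)\<^sup>2 = (p\<^sup>2 + q\<^sup>2) * (a\<^sup>2 + b\<^sup>2)"
    by (simp add: power2_eq_square algebra_simps)
  then show ?thesis by (simp add: assms)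
qed

lemma nn_integral_lborel_quarter_rotation:
  fixes f :: "real \<Rightarrow> real \<Rightarrow> ennreal"
  assumes [measurable]: "case_prod f \<in> borel_measurable (borel \<Otimes>\<^sub>M borel)" and unit: "\<bar>q\<bar> = 1"
  shows "(\<integral>\<^sup>+a. \<integral>\<^sup>+b. f (q * b) (- q * a) \<partial>lborel \<partial>lborel) = (\<integral>\<^sup>+a. \<integral>\<^sup>+b. f a b \<partial>lborel \<partial>lborel)"
proof -
  have reflect: "(\<integral>\<^sup>+x. g (c * x) \<partial>lborel) = (\<integral>\<^sup>+x. g x \<partial>lborel)"
    if "\<bar>c\<bar> = 1" "g \<in> borel_measurable borel" for c and g :: "real \<Rightarrow> ennreal"
    using nn_integral_real_affine[of g c 0] that by auto
  have "(\<integral>\<^sup>+a. \<integral>\<^sup>+b. f (q * b) (- q * a) \<partial>lborel \<partial>lborel) = (\<integral>\<^sup>+a. \<integral>\<^sup>+b. f b (- q * a) \<partial>lborel \<partial>lborel)"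
    using unit by (intro nn_integral_cong reflect) measurable
  also have "\<dots> = (\<integral>\<^sup>+b. \<integral>\<^sup>+a. f b (- q * a) \<partial>lborel \<partial>lborel)"
    by (rule lborel_pair.Fubini') measurable
  also have "\<dots> = (\<integral>\<^sup>+b. \<integral>\<^sup>+a. f b a \<partial>lborel \<partial>lborel)"
    using unit by (intro nn_integral_cong reflect) auto
  finally show ?thesis .
qed

lemma nn_integral_lborel_rotation:
  fixes f :: "real \<Rightarrow> real \<Rightarrow> ennreal"
  assumes [measurable]: "case_prod f \<in> borel_measurable (borel \<Otimes>\<^sub>M borel)"
    and unit: "p\<^sup>2 + q\<^sup>2 = 1"
  shows "(\<integral>\<^sup>+a. \<integral>\<^sup>+b. f (p * a + q * b) (p * b - q * a) \<partial>lborel \<partial>lborel)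
    = (\<integral>\<^sup>+a. \<integral>\<^sup>+b. f a b \<partial>lborel \<partial>lborel)"
proof (cases "p = 0")
  case True
  then have "\<bar>q\<bar> = 1" using unit by (auto simp: power2_eq_1_iff)
  then show ?thesis using nn_integral_lborel_quarter_rotation[of f q] True by simp
next
  case False
  have sheared: "p * b - q * a = (b - q * (p * a + q * b)) / p" for a b
  proof -
    have "p * (p * b - q * a) = (p\<^sup>2 + q\<^sup>2) * b - q * (p * a + q * b)"
      by (simp add: power2_eq_square algebra_simps)
    then show ?thesis using False unit by (simp add: eq_divide_eq mult.commute)
  qed
  have "(\<integral>\<^sup>+a. \<integral>\<^sup>+b. f (p * a + q * b) (p * b - q * a) \<partial>lborel \<partial>lborel)
      = (\<integral>\<^sup>+b. \<integral>\<^sup>+a. f (q * b + p * a) ((b - q * (q * b + p * a)) / p) \<partial>lborel \<partial>lborel)"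
    unfolding sheared by (subst lborel_pair.Fubini') (auto simp: add.commute)
  also have "ennreal \<bar>p\<bar> * \<dots> = (\<integral>\<^sup>+b. \<integral>\<^sup>+a. f a ((b - q * a) / p) \<partial>lborel \<partial>lborel)"
    by (subst nn_integral_cmult[symmetric], measurable, intro nn_integral_cong)
      (rule nn_integral_real_affine[symmetric]; use False in simp)
  also have "\<dots> = (\<integral>\<^sup>+a. \<integral>\<^sup>+b. f a ((b - q * a) / p) \<partial>lborel \<partial>lborel)"
    by (rule lborel_pair.Fubini') measurable
  also have "\<dots> = (\<integral>\<^sup>+a. ennreal \<bar>p\<bar> * (\<integral>\<^sup>+b. f a b \<partial>lborel) \<partial>lborel)"
  proof (rule nn_integral_cong)
    fix a
    show "(\<integral>\<^sup>+b. f a ((b - q * a) / p) \<partial>lborel) = ennreal \<bar>p\<bar> * (\<integral>\<^sup>+b. f a b \<partial>lborel)"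
      using nn_integral_real_affine[of "\<lambda>b. f a ((b - q * a) / p)" p "q * a"] False by simp
  qed
  also have "\<dots> = ennreal \<bar>p\<bar> * (\<integral>\<^sup>+a. \<integral>\<^sup>+b. f a b \<partial>lborel \<partial>lborel)"
    by (rule nn_integral_cmult) measurable
  finally show ?thesis using False by (simp add: ennreal_mult_cancel_left)
qed

lemma nn_integral_std_normal:
  assumes [measurable]: "f \<in> borel_measurable borel"
  shows "(\<integral>\<^sup>+x. f x \<partial>std_normal_distribution) = (\<integral>\<^sup>+x. ennreal (std_normal_density x) * f x \<partial>lborel)"
  by (rule nn_integral_density) auto

abbreviation normal_distribution :: "real \<Rightarrow> real \<Rightarrow> real measure" where
  "normal_distribution m \<sigma> \<equiv> density lborel (\<lambda>x. ennreal (normal_density m \<sigma> x))"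

lemma prob_space_std_normal: "prob_space std_normal_distribution"
  by (rule prob_space_normal_density) simp

lemma normal_distribution_eq_distr:
  assumes "\<sigma> > 0"
  shows "normal_distribution m \<sigma> = distr std_normal_distribution lborel (\<lambda>x. m + \<sigma> * x)"
proof -
  interpret prob_space std_normal_distribution by (rule prob_space_std_normal)
  have "distributed std_normal_distribution lborel (\<lambda>x. x) std_normal_density"
    by (simp add: distributed_def distr_id2)
  from normal_density_affine[OF this _ , of \<sigma> m] assms show ?thesis
    by (simp add: distributed_def)
qed

lemma std_normal_density_mult:
  "std_normal_density a * std_normal_density b = exp (- (a\<^sup>2 + b\<^sup>2) / 2) / (2 * pi)"
  by (simp add: std_normal_density_def exp_add[symmetric] field_simps real_sqrt_mult[symmetric])

lemma nn_integral_std_normal_rotation: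
  fixes f :: "real \<Rightarrow> real \<Rightarrow> ennreal"
  assumes [measurable]: "case_prod f \<in> borel_measurable (borel \<Otimes>\<^sub>M borel)"
    and unit: "p\<^sup>2 + q\<^sup>2 = 1"
  shows "(\<integral>\<^sup>+a. \<integral>\<^sup>+b. f (p * a + q * b) (p * b - q * a) \<partial>std_normal_distribution \<partial>std_normal_distribution)
    = (\<integral>\<^sup>+a. \<integral>\<^sup>+b. f a b \<partial>std_normal_distribution \<partial>std_normal_distribution)"
proof -
  define F where "F a b = ennreal (exp (- (a\<^sup>2 + b\<^sup>2) / 2) / (2 * pi)) * f a b" for a b
  have [measurable]: "case_prod F \<in> borel_measurable (borel \<Otimes>\<^sub>M borel)" unfolding F_def by measurable
  have density: "(\<integral>\<^sup>+a. \<integral>\<^sup>+b. g a b \<partial>std_normal_distribution \<partial>std_normal_distribution)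
    = (\<integral>\<^sup>+a. \<integral>\<^sup>+b. ennreal (exp (- (a\<^sup>2 + b\<^sup>2) / 2) / (2 * pi)) * g a b \<partial>lborel \<partial>lborel)"
    if [measurable]: "case_prod g \<in> borel_measurable (borel \<Otimes>\<^sub>M borel)" for g
    by (simp add: nn_integral_std_normal nn_integral_cmult[symmetric] mult.assoc[symmetric]
        ennreal_mult[symmetric] std_normal_density_mult)
  have "(\<integral>\<^sup>+a. \<integral>\<^sup>+b. F (p * a + q * b) (p * b - q * a) \<partial>lborel \<partial>lborel)
      = (\<integral>\<^sup>+a. \<integral>\<^sup>+b. F a b \<partial>lborel \<partial>lborel)"
    by (rule nn_integral_lborel_rotation) (measurable, rule unit)
  then show ?thesis by (simp add: density F_def sum_power2_rotation[OF unit])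
qed

lemma nn_integral_std_normal_linear_norm:
  fixes f :: "real \<Rightarrow> real \<Rightarrow> ennreal"
  assumes [measurable]: "case_prod f \<in> borel_measurable (borel \<Otimes>\<^sub>M borel)"
  shows "(\<integral>\<^sup>+a. \<integral>\<^sup>+b. f (p * a + q * b) (a\<^sup>2 + b\<^sup>2) \<partial>std_normal_distribution \<partial>std_normal_distribution)
    = (\<integral>\<^sup>+a. \<integral>\<^sup>+b. f (sqrt (p\<^sup>2 + q\<^sup>2) * a) (a\<^sup>2 + b\<^sup>2) \<partial>std_normal_distribution \<partial>std_normal_distribution)"
proof -
  define t where "t = sqrt (p\<^sup>2 + q\<^sup>2)"
  have t_square: "t\<^sup>2 = p\<^sup>2 + q\<^sup>2" by (simp add: t_def)
  obtain p' q' where p_eq: "p = t * p'" and q_eq: "q = t * q'" and unit: "p'\<^sup>2 + q'\<^sup>2 = 1"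
  proof (cases "t = 0")
    case True
    then have "p = 0" "q = 0" using t_square by (auto simp: sum_power2_eq_zero_iff)
    with True show ?thesis by (intro that[of 1 0]) auto
  next
    case False
    then have "(p / t)\<^sup>2 + (q / t)\<^sup>2 = 1"
      by (simp add: power_divide add_divide_distrib[symmetric] flip: t_square)
    with False show ?thesis by (intro that[of "p / t" "q / t"]) auto
  qed
  define h where "h x y = f (t * x) (x\<^sup>2 + y\<^sup>2)" for x y
  have [measurable]: "case_prod h \<in> borel_measurable (borel \<Otimes>\<^sub>M borel)"
    unfolding h_def by measurable
  have "f (p * a + q * b) (a\<^sup>2 + b\<^sup>2) = h (p' * a + q' * b) (p' * b - q' * a)" for a b
    unfolding h_def sum_power2_rotation[OF unit] by (simp add: p_eq q_eq algebra_simps)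
  then show ?thesis
    using nn_integral_std_normal_rotation[of h p' q'] unit by (simp add: h_def t_def)
qed

section \<open>Gaussian vectors and the chi distribution\<close>

definition gauss :: "nat \<Rightarrow> (nat \<Rightarrow> real) measure" where
  "gauss n = PiM {..<n} (\<lambda>_. std_normal_distribution)"

definition chi :: "nat \<Rightarrow> real measure" where
  "chi n = distr (gauss n) borel (\<lambda>z. sqrt (\<Sum>i<n. (z i)\<^sup>2))"

lemma sets_gauss[measurable_cong]: "sets (gauss n) = sets (PiM {..<n} (\<lambda>_. borel))"
  unfolding gauss_def by (intro sets_PiM_cong) auto

lemma prob_space_gauss: "prob_space (gauss n)"
  unfolding gauss_def by (intro prob_space_PiM prob_space_std_normal)

lemma nn_integral_gauss_Suc:
  assumes "f \<in> borel_measurable (gauss (Suc n))"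
  shows "(\<integral>\<^sup>+z. f z \<partial>gauss (Suc n)) = (\<integral>\<^sup>+b. \<integral>\<^sup>+z. f (z(n := b)) \<partial>gauss n \<partial>std_normal_distribution)"
proof -
  interpret product_sigma_finite "\<lambda>_::nat. std_normal_distribution"
    by (intro product_sigma_finite.intro prob_space_imp_sigma_finite prob_space_std_normal)
  show ?thesis
    using assms unfolding gauss_def lessThan_Suc by (intro product_nn_integral_insert_rev) auto
qed

lemma sets_chi[simp, measurable_cong]: "sets (chi n) = sets borel"
  and space_chi[simp]: "space (chi n) = UNIV"
  by (auto simp: chi_def)

lemma prob_space_chi: "prob_space (chi n)"
  unfolding chi_def by (rule prob_space.prob_space_distr[OF prob_space_gauss]) measurable

lemma nn_integral_chi:
  assumes [measurable]: "f \<in> borel_measurable borel"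
  shows "(\<integral>\<^sup>+r. f r \<partial>chi n) = (\<integral>\<^sup>+z. f (sqrt (\<Sum>i<n. (z i)\<^sup>2)) \<partial>gauss n)"
  unfolding chi_def by (rule nn_integral_distr) measurable

lemma nn_integral_chi_Suc:
  assumes [measurable]: "f \<in> borel_measurable borel"
  shows "(\<integral>\<^sup>+r. f r \<partial>chi (Suc n)) = (\<integral>\<^sup>+b. \<integral>\<^sup>+r. f (sqrt (r\<^sup>2 + b\<^sup>2)) \<partial>chi n \<partial>std_normal_distribution)"
  by (simp add: nn_integral_chi nn_integral_gauss_Suc sum_nonneg)

lemma nn_integral_std_normal_mult_abs:
  fixes f :: "real \<Rightarrow> real \<Rightarrow> ennreal"
  assumes [measurable]: "case_prod f \<in> borel_measurable (borel \<Otimes>\<^sub>M borel)"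
  shows "(\<integral>\<^sup>+a. f (c * a) (a\<^sup>2) \<partial>std_normal_distribution)
      = (\<integral>\<^sup>+a. f (\<bar>c\<bar> * a) (a\<^sup>2) \<partial>std_normal_distribution)"
proof -
  interpret N: prob_space std_normal_distribution by (rule prob_space_std_normal)
  have "(\<integral>\<^sup>+a. f (\<bar>c\<bar> * (- a)) (a\<^sup>2) \<partial>std_normal_distribution)
      = (\<integral>\<^sup>+a. f (\<bar>c\<bar> * a) (a\<^sup>2) \<partial>std_normal_distribution)"
    using nn_integral_std_normal_rotation[of "\<lambda>a _. f (\<bar>c\<bar> * a) (a\<^sup>2)" "-1" 0]
    by (simp add: N.emeasure_space_1[simplified])
  then show ?thesis by (cases "c \<ge> 0") auto
qed

lemma nn_integral_chi_linear_norm: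
  fixes f :: "real \<Rightarrow> real \<Rightarrow> ennreal"
  assumes [measurable]: "case_prod f \<in> borel_measurable (borel \<Otimes>\<^sub>M borel)"
  shows "(\<integral>\<^sup>+b. \<integral>\<^sup>+a. \<integral>\<^sup>+r. f (p * a + q * b) (a\<^sup>2 + r\<^sup>2 + b\<^sup>2) \<partial>chi n
      \<partial>std_normal_distribution \<partial>std_normal_distribution)
    = (\<integral>\<^sup>+a. \<integral>\<^sup>+r. f (sqrt (p\<^sup>2 + q\<^sup>2) * a) (a\<^sup>2 + r\<^sup>2) \<partial>chi (Suc n) \<partial>std_normal_distribution)"
proof -
  interpret N: pair_sigma_finite std_normal_distribution std_normal_distribution
    by (intro pair_sigma_finite.intro prob_space_imp_sigma_finite prob_space_std_normal)
  interpret chi: prob_space "chi n" by (rule prob_space_chi)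
  define h where "h x y = (\<integral>\<^sup>+r. f x (y + r\<^sup>2) \<partial>chi n)" for x y
  have [measurable]: "case_prod h \<in> borel_measurable (borel \<Otimes>\<^sub>M borel)"
    unfolding h_def by measurable
  have "(\<integral>\<^sup>+b. \<integral>\<^sup>+a. \<integral>\<^sup>+r. f (p * a + q * b) (a\<^sup>2 + r\<^sup>2 + b\<^sup>2) \<partial>chi n
        \<partial>std_normal_distribution \<partial>std_normal_distribution)
      = (\<integral>\<^sup>+b. \<integral>\<^sup>+a. h (p * a + q * b) (a\<^sup>2 + b\<^sup>2) \<partial>std_normal_distribution \<partial>std_normal_distribution)"
    by (simp add: h_def ac_simps)
  also have "\<dots> = (\<integral>\<^sup>+a. \<integral>\<^sup>+b. h (p * a + q * b) (a\<^sup>2 + b\<^sup>2) \<partial>std_normal_distribution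
      \<partial>std_normal_distribution)"
    by (rule N.Fubini') measurable
  also have "\<dots> = (\<integral>\<^sup>+a. \<integral>\<^sup>+b. h (sqrt (p\<^sup>2 + q\<^sup>2) * a) (a\<^sup>2 + b\<^sup>2) \<partial>std_normal_distribution
      \<partial>std_normal_distribution)"
    by (rule nn_integral_std_normal_linear_norm) measurable
  also have "\<dots> = (\<integral>\<^sup>+a. \<integral>\<^sup>+r. f (sqrt (p\<^sup>2 + q\<^sup>2) * a) (a\<^sup>2 + r\<^sup>2) \<partial>chi (Suc n) \<partial>std_normal_distribution)"
    by (simp add: nn_integral_chi_Suc h_def ac_simps)
  finally show ?thesis .
qed

lemma nn_integral_gauss_inner_norm:
  fixes f :: "real \<Rightarrow> real \<Rightarrow> ennreal" and u :: "nat \<Rightarrow> real"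
  assumes "case_prod f \<in> borel_measurable (borel \<Otimes>\<^sub>M borel)"
  shows "(\<integral>\<^sup>+z. f (\<Sum>i<Suc n. u i * z i) (\<Sum>i<Suc n. (z i)\<^sup>2) \<partial>gauss (Suc n))
    = (\<integral>\<^sup>+a. \<integral>\<^sup>+r. f (sqrt (\<Sum>i<Suc n. (u i)\<^sup>2) * a) (a\<^sup>2 + r\<^sup>2) \<partial>chi n \<partial>std_normal_distribution)"
  using assms
proof (induction n arbitrary: f)
  case 0
  note [measurable] = 0
  interpret G: prob_space "gauss 0" by (rule prob_space_gauss)
  have "(\<integral>\<^sup>+z. f (\<Sum>i<Suc 0. u i * z i) (\<Sum>i<Suc 0. (z i)\<^sup>2) \<partial>gauss (Suc 0))
      = (\<integral>\<^sup>+a. f (u 0 * a) (a\<^sup>2) \<partial>std_normal_distribution)"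
    by (subst nn_integral_gauss_Suc) (simp_all add: G.emeasure_space_1)
  also have "\<dots> = (\<integral>\<^sup>+a. f (\<bar>u 0\<bar> * a) (a\<^sup>2) \<partial>std_normal_distribution)"
    by (rule nn_integral_std_normal_mult_abs) measurable
  finally show ?case by (simp add: nn_integral_chi G.emeasure_space_1)
next
  case (Suc n)
  note [measurable] = Suc.prems
  interpret chi: prob_space "chi n" by (rule prob_space_chi)
  define p where "p = sqrt (\<Sum>i<Suc n. (u i)\<^sup>2)"
  define q where "q = u (Suc n)"
  have norm_u: "sqrt (p\<^sup>2 + q\<^sup>2) = sqrt (\<Sum>i<Suc (Suc n). (u i)\<^sup>2)" by (simp add: p_def q_def sum_nonneg)
  have "(\<integral>\<^sup>+z. f (\<Sum>i<Suc (Suc n). u i * z i) (\<Sum>i<Suc (Suc n). (z i)\<^sup>2) \<partial>gauss (Suc (Suc n)))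
      = (\<integral>\<^sup>+b. \<integral>\<^sup>+z. f ((\<Sum>i<Suc n. u i * z i) + q * b) ((\<Sum>i<Suc n. (z i)\<^sup>2) + b\<^sup>2) \<partial>gauss (Suc n)
          \<partial>std_normal_distribution)"
    unfolding q_def by (subst nn_integral_gauss_Suc) auto
  also have "\<dots> = (\<integral>\<^sup>+b. \<integral>\<^sup>+a. \<integral>\<^sup>+r. f (p * a + q * b) (a\<^sup>2 + r\<^sup>2 + b\<^sup>2) \<partial>chi n
      \<partial>std_normal_distribution \<partial>std_normal_distribution)"
    unfolding p_def
    by (intro nn_integral_cong Suc.IH[of "\<lambda>x y. f (x + q * _) (y + _\<^sup>2)"]) measurable
  also have "\<dots> = (\<integral>\<^sup>+a. \<integral>\<^sup>+r. f (sqrt (p\<^sup>2 + q\<^sup>2) * a) (a\<^sup>2 + r\<^sup>2) \<partial>chi (Suc n) \<partial>std_normal_distribution)"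
    by (rule nn_integral_chi_linear_norm) measurable
  finally show ?case unfolding norm_u .
qed

section \<open>The density of the chi distribution\<close>

lemma nn_integral_power_scale:
  fixes g :: "real \<Rightarrow> ennreal"
  assumes "s > 0" and [measurable]: "g \<in> borel_measurable borel"
  shows "(\<integral>\<^sup>+r. ennreal (indicator {0<..} r * r ^ k) * g (s * r) \<partial>lborel)
    = ennreal (1 / s ^ Suc k) * (\<integral>\<^sup>+r. ennreal (indicator {0<..} r * r ^ k) * g r \<partial>lborel)"
proof -
  have "ennreal (1 / s) * (ennreal (indicator {0<..} (r / s) * (r / s) ^ k) * g r)
      = ennreal (1 / s ^ Suc k) * (ennreal (indicator {0<..} r * r ^ k) * g r)" for r
  proof -
    have "1 / s * (indicator {0<..} (r / s) * (r / s) ^ k) = 1 / s ^ Suc k * (indicator {0<..} r * r ^ k)"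
      using assms(1) by (simp add: indicator_def power_divide zero_less_divide_iff)
    then show ?thesis
      using assms(1) by (simp only: mult.assoc[symmetric] ennreal_mult'[symmetric] zero_le_divide_1_iff
          zero_le_power less_imp_le)
  qed
  then show ?thesis
    using assms(1)
    by (subst nn_integral_real_affine[where c="1 / s" and t=0]) (auto simp: nn_integral_cmult[symmetric])
qed

text \<open>Substitutes \<open>b = r v\<close> for fixed \<open>r\<close>, then rescales \<open>r\<close> for fixed \<open>v\<close>; the constant is the
  integral over the slope \<open>v\<close>.\<close>
lemma nn_integral_half_plane_radial:
  fixes g :: "real \<Rightarrow> ennreal"
  assumes [measurable]: "g \<in> borel_measurable borel"
  shows "(\<integral>\<^sup>+b. \<integral>\<^sup>+r. ennreal (indicator {0<..} r * r ^ j) * g (sqrt (r\<^sup>2 + b\<^sup>2)) \<partial>lborel \<partial>lborel)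
    = (\<integral>\<^sup>+v. ennreal (1 / sqrt (1 + v\<^sup>2) ^ (j + 2)) \<partial>lborel)
      * (\<integral>\<^sup>+r. ennreal (indicator {0<..} r * r ^ Suc j) * g r \<partial>lborel)"
proof -
  have slope: "(\<integral>\<^sup>+b. ennreal (indicator {0<..} r * r ^ j) * g (sqrt (r\<^sup>2 + b\<^sup>2)) \<partial>lborel)
      = (\<integral>\<^sup>+v. ennreal (indicator {0<..} r * r ^ Suc j) * g (sqrt (1 + v\<^sup>2) * r) \<partial>lborel)" for r
  proof (cases "r > 0")
    case True
    have "sqrt (r\<^sup>2 + (0 + r * v)\<^sup>2) = sqrt (1 + v\<^sup>2) * r" for v
    proof -
      have "sqrt (r\<^sup>2 + (0 + r * v)\<^sup>2) = sqrt ((1 + v\<^sup>2) * r\<^sup>2)" by (simp add: algebra_simps)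
      then show ?thesis using True by (simp add: real_sqrt_mult)
    qed
    then show ?thesis
      using True
      by (subst nn_integral_real_affine[where c=r and t=0])
        (auto simp: nn_integral_cmult[symmetric] ennreal_mult mult.assoc)
  qed simp
  have "(\<integral>\<^sup>+b. \<integral>\<^sup>+r. ennreal (indicator {0<..} r * r ^ j) * g (sqrt (r\<^sup>2 + b\<^sup>2)) \<partial>lborel \<partial>lborel)
      = (\<integral>\<^sup>+r. \<integral>\<^sup>+b. ennreal (indicator {0<..} r * r ^ j) * g (sqrt (r\<^sup>2 + b\<^sup>2)) \<partial>lborel \<partial>lborel)"
    by (rule lborel_pair.Fubini') measurable
  also have "\<dots> = (\<integral>\<^sup>+v. \<integral>\<^sup>+r. ennreal (indicator {0<..} r * r ^ Suc j) * g (sqrt (1 + v\<^sup>2) * r)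
      \<partial>lborel \<partial>lborel)"
    unfolding slope by (rule lborel_pair.Fubini') measurable
  also have "\<dots> = (\<integral>\<^sup>+v. ennreal (1 / sqrt (1 + v\<^sup>2) ^ (j + 2))
      * (\<integral>\<^sup>+r. ennreal (indicator {0<..} r * r ^ Suc j) * g r \<partial>lborel) \<partial>lborel)"
    by (subst nn_integral_power_scale) (auto simp: add_pos_nonneg)
  also have "\<dots> = (\<integral>\<^sup>+v. ennreal (1 / sqrt (1 + v\<^sup>2) ^ (j + 2)) \<partial>lborel)
      * (\<integral>\<^sup>+r. ennreal (indicator {0<..} r * r ^ Suc j) * g r \<partial>lborel)"
    by (rule nn_integral_multc) measurable
  finally show ?thesis .
qed

definition chi_weight :: "nat \<Rightarrow> real \<Rightarrow> real" where
  "chi_weight j r = indicator {0<..} r * (r ^ j * exp (- r\<^sup>2 / 2))"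

definition chi_const :: "nat \<Rightarrow> real" where
  "chi_const j = (\<integral>r. chi_weight j r \<partial>lborel)"

lemma chi_weight_nonneg[simp]: "chi_weight j r \<ge> 0"
  by (auto simp: chi_weight_def indicator_def)

lemma measurable_chi_weight[measurable]: "chi_weight j \<in> borel_measurable borel"
  unfolding chi_weight_def by measurable

lemma nn_integral_std_normal_abs:
  assumes [measurable]: "g \<in> borel_measurable borel"
  shows "(\<integral>\<^sup>+b. g \<bar>b\<bar> \<partial>std_normal_distribution)
    = ennreal (2 / sqrt (2 * pi)) * (\<integral>\<^sup>+r. ennreal (chi_weight 0 r) * g r \<partial>lborel)"
proof -
  let ?w = "\<lambda>b. ennreal (1 / sqrt (2 * pi)) * (ennreal (chi_weight 0 b) * g b)"
  have "(\<integral>\<^sup>+b. g \<bar>b\<bar> \<partial>std_normal_distribution) = (\<integral>\<^sup>+b. ennreal (std_normal_density b) * g \<bar>b\<bar> \<partial>lborel)"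
    by (rule nn_integral_std_normal) measurable
  also have "\<dots> = (\<integral>\<^sup>+b. ?w b + ?w (- b) \<partial>lborel)"
  proof (rule nn_integral_cong_AE)
    have "AE b in lborel. b \<noteq> (0::real)" by (rule AE_lborel_singleton)
    then show "AE b in lborel. ennreal (std_normal_density b) * g \<bar>b\<bar> = ?w b + ?w (- b)"
    proof eventually_elim
      case (elim b)
      then show ?case
        by (cases "b > 0")
          (auto simp: chi_weight_def std_normal_density_def mult.assoc[symmetric] ennreal_mult[symmetric])
    qed
  qed
  also have "\<dots> = (\<integral>\<^sup>+b. ?w b \<partial>lborel) + (\<integral>\<^sup>+b. ?w (- b) \<partial>lborel)"
    by (rule nn_integral_add) measurable
  also have "(\<integral>\<^sup>+b. ?w (- b) \<partial>lborel) = (\<integral>\<^sup>+b. ?w b \<partial>lborel)"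
    using nn_integral_real_affine[of ?w "-1" 0] by simp
  also have "(\<integral>\<^sup>+b. ?w b \<partial>lborel)
      = ennreal (1 / sqrt (2 * pi)) * (\<integral>\<^sup>+b. ennreal (chi_weight 0 b) * g b \<partial>lborel)"
    by (rule nn_integral_cmult) measurable
  finally show ?thesis
    by (simp add: distrib_right[symmetric] ennreal_plus[symmetric] del: ennreal_plus)
qed

lemma nn_integral_chi_weight_radial:
  assumes [measurable]: "f \<in> borel_measurable borel"
  shows "(\<integral>\<^sup>+b. \<integral>\<^sup>+r. ennreal (chi_weight j r) * f (sqrt (r\<^sup>2 + b\<^sup>2)) \<partial>lborel \<partial>std_normal_distribution)
    = (\<integral>\<^sup>+v. ennreal (1 / sqrt (1 + v\<^sup>2) ^ (j + 2)) \<partial>lborel) * ennreal (1 / sqrt (2 * pi))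
      * (\<integral>\<^sup>+r. ennreal (chi_weight (Suc j) r) * f r \<partial>lborel)"
proof -
  define g where "g y = ennreal (1 / sqrt (2 * pi)) * (ennreal (exp (- y\<^sup>2 / 2)) * f y)" for y
  have [measurable]: "g \<in> borel_measurable borel" unfolding g_def by measurable
  have integrand: "ennreal (std_normal_density b) * (ennreal (chi_weight j r) * f (sqrt (r\<^sup>2 + b\<^sup>2)))
      = ennreal (indicator {0<..} r * r ^ j) * g (sqrt (r\<^sup>2 + b\<^sup>2))" for r b
  proof -
    have "std_normal_density b * chi_weight j r
        = indicator {0<..} r * r ^ j * (1 / sqrt (2 * pi) * exp (- (sqrt (r\<^sup>2 + b\<^sup>2))\<^sup>2 / 2))"
      by (simp add: chi_weight_def std_normal_density_def exp_add[symmetric] add_divide_distrib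
          diff_divide_distrib)
    then show ?thesis
      by (simp add: g_def mult.assoc[symmetric] ennreal_mult''[symmetric] del: real_sqrt_pow2)
  qed
  have "(\<integral>\<^sup>+b. \<integral>\<^sup>+r. ennreal (chi_weight j r) * f (sqrt (r\<^sup>2 + b\<^sup>2)) \<partial>lborel \<partial>std_normal_distribution)
      = (\<integral>\<^sup>+b. \<integral>\<^sup>+r. ennreal (indicator {0<..} r * r ^ j) * g (sqrt (r\<^sup>2 + b\<^sup>2)) \<partial>lborel \<partial>lborel)"
    by (simp add: nn_integral_std_normal nn_integral_cmult[symmetric] integrand)
  also have "\<dots> = (\<integral>\<^sup>+v. ennreal (1 / sqrt (1 + v\<^sup>2) ^ (j + 2)) \<partial>lborel)
      * (\<integral>\<^sup>+r. ennreal (indicator {0<..} r * r ^ Suc j) * g r \<partial>lborel)"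
    by (rule nn_integral_half_plane_radial) measurable
  also have "(\<integral>\<^sup>+r. ennreal (indicator {0<..} r * r ^ Suc j) * g r \<partial>lborel)
      = (\<integral>\<^sup>+r. ennreal (1 / sqrt (2 * pi)) * (ennreal (chi_weight (Suc j) r) * f r) \<partial>lborel)"
    by (intro nn_integral_cong)
      (auto simp: g_def chi_weight_def mult.assoc[symmetric] ennreal_mult[symmetric] indicator_def)
  also have "\<dots> = ennreal (1 / sqrt (2 * pi)) * (\<integral>\<^sup>+r. ennreal (chi_weight (Suc j) r) * f r \<partial>lborel)"
    by (rule nn_integral_cmult) measurable
  finally show ?thesis by (simp add: mult.assoc)
qed

lemma nn_integral_chi_proportional:
  "\<exists>K. \<forall>f. f \<in> borel_measurable borel \<longrightarrow>
    (\<integral>\<^sup>+r. f r \<partial>chi (Suc j)) = K * (\<integral>\<^sup>+r. ennreal (chi_weight j r) * f r \<partial>lborel)"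
proof (induction j)
  case 0
  interpret G: prob_space "gauss 0" by (rule prob_space_gauss)
  show ?case
    by (intro exI[of _ "ennreal (2 / sqrt (2 * pi))"] allI impI, subst nn_integral_chi_Suc)
      (simp_all add: nn_integral_chi G.emeasure_space_1 nn_integral_std_normal_abs)
next
  case (Suc j)
  then obtain K where proportional: "\<And>f. f \<in> borel_measurable borel \<Longrightarrow>
      (\<integral>\<^sup>+r. f r \<partial>chi (Suc j)) = K * (\<integral>\<^sup>+r. ennreal (chi_weight j r) * f r \<partial>lborel)"
    by blast
  define S where "S = (\<integral>\<^sup>+v. ennreal (1 / sqrt (1 + v\<^sup>2) ^ (j + 2)) \<partial>lborel)"
  have "(\<integral>\<^sup>+r. f r \<partial>chi (Suc (Suc j)))
      = K * (S * ennreal (1 / sqrt (2 * pi))) * (\<integral>\<^sup>+r. ennreal (chi_weight (Suc j) r) * f r \<partial>lborel)"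
    if [measurable]: "f \<in> borel_measurable borel" for f
  proof -
    have "(\<integral>\<^sup>+r. f r \<partial>chi (Suc (Suc j)))
        = (\<integral>\<^sup>+b. K * (\<integral>\<^sup>+r. ennreal (chi_weight j r) * f (sqrt
          (r\<^sup>2 + b\<^sup>2)) \<partial>lborel) \<partial>std_normal_distribution)"
      by (subst nn_integral_chi_Suc) (simp_all add: proportional)
    also have "\<dots> = K * (\<integral>\<^sup>+b. \<integral>\<^sup>+r. ennreal (chi_weight j r) * f (sqrt (r\<^sup>2 + b\<^sup>2)) \<partial>lborel
        \<partial>std_normal_distribution)"
      by (rule nn_integral_cmult) measurable
    finally show ?thesis by (simp add: nn_integral_chi_weight_radial S_def mult.assoc)
  qed
  then show ?case by blast
qed

lemma nn_integral_chi_weight: "(\<integral>\<^sup>+r. ennreal (chi_weight j r) \<partial>lborel) = ennreal (chi_const j)"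
  and integrable_chi_weight[simp]: "integrable lborel (chi_weight j)"
  and chi_const_pos[simp]: "chi_const j > 0"
  and nn_integral_chi_weight_mult: "f \<in> borel_measurable borel \<Longrightarrow>
    (\<integral>\<^sup>+r. ennreal (chi_weight j r) * f r \<partial>lborel) = ennreal (chi_const j) * (\<integral>\<^sup>+r. f r \<partial>chi (Suc j))"
proof -
  let ?I = "\<integral>\<^sup>+r. ennreal (chi_weight j r) \<partial>lborel"
  interpret chi: prob_space "chi (Suc j)" by (rule prob_space_chi)
  obtain K where proportional: "\<And>f. f \<in> borel_measurable borel \<Longrightarrow>
      (\<integral>\<^sup>+r. f r \<partial>chi (Suc j)) = K * (\<integral>\<^sup>+r. ennreal (chi_weight j r) * f r \<partial>lborel)"
    using nn_integral_chi_proportional by blast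
  have normalized: "K * ?I = 1" using proportional[of "\<lambda>_. 1"] chi.emeasure_space_1 by simp
  then have "?I \<noteq> 0" "?I \<noteq> \<top>" by (auto simp: ennreal_mult_top split: if_splits)
  show weight_integrable: "integrable lborel (chi_weight j)"
    using \<open>?I \<noteq> \<top>\<close> by (intro integrableI_nonneg) (auto simp: less_top)
  show integral_weight: "?I = ennreal (chi_const j)"
    unfolding chi_const_def by (intro nn_integral_eq_integral weight_integrable) auto
  show "chi_const j > 0" using \<open>?I \<noteq> 0\<close> unfolding integral_weight by (simp add: ennreal_eq_0_iff not_le)
  show "(\<integral>\<^sup>+r. ennreal (chi_weight j r) * f r \<partial>lborel) = ennreal (chi_const j) * (\<integral>\<^sup>+r. f r \<partial>chi (Suc j))"
    if "f \<in> borel_measurable borel"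
    using normalized
    unfolding proportional[OF that] integral_weight by (simp add: mult.assoc[symmetric] mult.commute)
qed

lemma chi_Suc_eq_density: "chi (Suc j) = density lborel (\<lambda>r. ennreal (chi_weight j r / chi_const j))"
proof (rule measure_eqI)
  fix A assume "A \<in> sets (chi (Suc j))"
  then have [measurable]: "A \<in> sets borel" by simp
  have "emeasure (chi (Suc j)) A = (\<integral>\<^sup>+r. indicator A r \<partial>chi (Suc j))" by simp
  also have "\<dots> = ennreal (1 / chi_const j) * (ennreal (chi_const j) * (\<integral>\<^sup>+r. indicator A r \<partial>chi (Suc j)))"
    using chi_const_pos[of j] by (simp only: mult.assoc[symmetric])
      (simp add: ennreal_mult[symmetric] less_imp_le order_less_imp_not_eq2)
  also have "\<dots> = (\<integral>\<^sup>+r. ennreal (chi_weight j r / chi_const j) * indicator A r \<partial>lborel)"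
    by (subst nn_integral_chi_weight_mult[symmetric], measurable, subst nn_integral_cmult[symmetric])
      (auto simp: mult.assoc[symmetric] ennreal_mult'[symmetric] less_imp_le)
  also have "\<dots> = emeasure (density lborel (\<lambda>r. ennreal (chi_weight j r / chi_const j))) A"
    by (rule emeasure_density[symmetric]) auto
  finally show "emeasure (chi (Suc j)) A = \<dots>" .
qed simp

lemma AE_chi_pos:
  assumes "n > 0" shows "AE r in chi n. 0 < r"
proof -
  obtain j where n_Suc: "n = Suc j" using assms gr0_implies_Suc by blast
  show ?thesis
    unfolding n_Suc chi_Suc_eq_density
    by (subst AE_density) (auto simp: chi_weight_def indicator_def)
qed

lemma AE_gauss_norm_pos:
  assumes "n > 0" shows "AE z in gauss n. 0 < (\<Sum>i<n. (z i)\<^sup>2)"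
proof -
  have "AE z in gauss n. 0 < sqrt (\<Sum>i<n. (z i)\<^sup>2)"
    using AE_chi_pos[OF assms] unfolding chi_def by (subst (asm) AE_distr_iff) auto
  then show ?thesis by simp
qed

lemma nn_integral_std_normal_power2: "(\<integral>\<^sup>+x. ennreal (x\<^sup>2) \<partial>std_normal_distribution) = 1"
  using std_normal_distribution_even_moments[of 1]
  by (subst nn_integral_eq_integral) auto

lemma nn_integral_chi_power2: "(\<integral>\<^sup>+r. ennreal (r\<^sup>2) \<partial>chi n) = of_nat n"
proof (induction n)
  case 0
  show ?case by (simp add: nn_integral_chi)
next
  case (Suc n)
  interpret N: prob_space std_normal_distribution by (rule prob_space_std_normal)
  interpret chi: prob_space "chi n" by (rule prob_space_chi)
  show ?case
    by (simp add: nn_integral_chi_Suc nn_integral_add Suc chi.emeasure_space_1[simplified]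
        N.emeasure_space_1[simplified] nn_integral_std_normal_power2 add.commute)
qed

lemma nn_integral_chi_mean_le: "(\<integral>\<^sup>+r. ennreal r \<partial>chi n) \<le> ennreal (sqrt n)"
proof -
  interpret chi: prob_space "chi n" by (rule prob_space_chi)
  have nonneg: "AE r in chi n. 0 \<le> r"
    unfolding chi_def by (subst AE_distr_iff) (auto simp: sum_nonneg)
  have "(\<integral>\<^sup>+r. ennreal r \<partial>chi n)\<^sup>2 \<le> (\<integral>\<^sup>+r. (ennreal r)\<^sup>2 \<partial>chi n)"
    using Cauchy_Schwarz_nn_integral[of "\<lambda>r. ennreal r" "chi n" "\<lambda>_. 1"] chi.emeasure_space_1 by simp
  also have "\<dots> = (\<integral>\<^sup>+r. ennreal (r\<^sup>2) \<partial>chi n)"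
    by (rule nn_integral_cong_AE) (use nonneg in \<open>eventually_elim, simp add: ennreal_power\<close>)
  also have "\<dots> = (ennreal (sqrt n))\<^sup>2"
    by (simp add: nn_integral_chi_power2 ennreal_power ennreal_of_nat_eq_real_of_nat)
  finally have power2_le: "(\<integral>\<^sup>+r. ennreal r \<partial>chi n)\<^sup>2 \<le> (ennreal (sqrt n))\<^sup>2" .
  show ?thesis
  proof (cases "\<integral>\<^sup>+r. ennreal r \<partial>chi n")
    case (real m)
    then show ?thesis using power2_le by (auto simp: ennreal_power intro!: ennreal_leI real_le_rsqrt)
  next
    case top
    then show ?thesis using power2_le by (simp add: ennreal_power top_unique)
  qed
qed

lemma chi_const_add: "ennreal (chi_const (j + k))
    = ennreal (chi_const j) * (\<integral>\<^sup>+r. ennreal (r ^ k) \<partial>chi (Suc j))"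
proof -
  have "ennreal (chi_weight (j + k) r) = ennreal (chi_weight j r) * ennreal (r ^ k)" for r
    by (cases "r > 0") (auto simp: chi_weight_def ennreal_mult[symmetric] power_add)
  then show ?thesis
    by (subst nn_integral_chi_weight[symmetric]) (simp add: nn_integral_chi_weight_mult)
qed

lemma chi_const_Suc_Suc: "chi_const (Suc (Suc j)) = real (Suc j) * chi_const j"
proof -
  have "ennreal (chi_const (Suc (Suc j))) = ennreal (real (Suc j) * chi_const j)"
    using chi_const_add[of j 2]
    by (simp add: nn_integral_chi_power2 ennreal_of_nat_eq_real_of_nat ennreal_mult'' less_imp_le mult.commute
        del: of_nat_Suc)
  then show ?thesis by (subst (asm) ennreal_inj) (auto simp: less_imp_le)
qed

lemma chi_const_Suc_le: "chi_const (Suc j) \<le> sqrt (Suc j) * chi_const j"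
proof -
  have "ennreal (chi_const (Suc j)) \<le> ennreal (chi_const j) * ennreal (sqrt (Suc j))"
    using chi_const_add[of j 1] nn_integral_chi_mean_le[of "Suc j"] by
      (simp add: mult_left_mono del: of_nat_Suc)
  then show ?thesis
    by (simp add: ennreal_mult''[symmetric] mult.commute less_imp_le del: of_nat_Suc)
qed

lemma chi_const_Suc_ge: "sqrt (Suc j) * chi_const (Suc j) \<le> chi_const (Suc (Suc j))"
proof -
  have "sqrt (Suc j) * chi_const (Suc j) \<le> sqrt (Suc j) * (sqrt (Suc j) * chi_const j)"
    by (intro mult_left_mono chi_const_Suc_le) simp
  also have "\<dots> = chi_const (Suc (Suc j))"
    unfolding chi_const_Suc_Suc mult.assoc[symmetric] by simp
  finally show ?thesis .
qed

section \<open>Tails of the chi and the normal distribution\<close>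

lemma nn_integral_chi_gaussian_tilt:
  fixes w :: real
  shows "(\<integral>\<^sup>+r. ennreal (exp (- (w * r)\<^sup>2 / 2) / r ^ k) \<partial>chi (Suc (i + k)))
    = ennreal (chi_const i / (chi_const (i + k) * sqrt (1 + w\<^sup>2) ^ Suc i))"
proof -
  define s where "s = sqrt (1 + w\<^sup>2)"
  have s_props: "s > 0" "s\<^sup>2 = 1 + w\<^sup>2" by (auto simp: s_def add_pos_nonneg)
  let ?g = "\<lambda>r. ennreal (exp (- r\<^sup>2 / 2))"
  have tilt: "ennreal (chi_weight (i + k) r) * ennreal (exp (- (w * r)\<^sup>2 / 2) / r ^ k)
      = ennreal (indicator {0<..} r * r ^ i) * ?g (s * r)" for r
  proof (cases "r > 0")
    case True
    have "exp (- (s * r)\<^sup>2 / 2) = exp (- r\<^sup>2 / 2) * exp (- (w * r)\<^sup>2 / 2)"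
      by (simp add: exp_add[symmetric] power_mult_distrib s_props(2) field_simps)
    then show ?thesis
      using True by (simp add: chi_weight_def power_add ennreal_mult'[symmetric] field_simps)
  qed (simp add: chi_weight_def)
  have "ennreal (chi_const (i + k)) * (\<integral>\<^sup>+r. ennreal (exp (- (w * r)\<^sup>2 / 2) / r ^ k) \<partial>chi (Suc (i + k)))
      = (\<integral>\<^sup>+r. ennreal (indicator {0<..} r * r ^ i) * ?g (s * r) \<partial>lborel)"
    unfolding tilt[symmetric] by (rule nn_integral_chi_weight_mult[symmetric]) measurable
  also have "\<dots> = ennreal (1 / s ^ Suc i) * (\<integral>\<^sup>+r. ennreal (indicator {0<..} r * r ^ i) * ?g r \<partial>lborel)"
    by (rule nn_integral_power_scale) (use s_props in measurable)
  also have "(\<integral>\<^sup>+r. ennreal (indicator {0<..} r * r ^ i) * ?g r \<partial>lborel) = ennreal (chi_const i)"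
    by (simp add: nn_integral_chi_weight[symmetric] chi_weight_def ennreal_mult''[symmetric] mult.assoc)
  also have "ennreal (1 / s ^ Suc i) * ennreal (chi_const i)
      = ennreal (chi_const (i + k)) * ennreal (chi_const i / (chi_const (i + k) * s ^ Suc i))"
    using s_props(1) chi_const_pos[of "i + k"]
    by (simp add: ennreal_mult'[symmetric] less_imp_le order_less_imp_not_eq2)
  finally show ?thesis
    using chi_const_pos[of "i + k"] unfolding s_def
    by (subst (asm) ennreal_mult_cancel_left) (auto simp: ennreal_eq_0_iff)
qed

lemma chi_const_ratio_le: "chi_const i / chi_const (i + 3) \<le> 1 / (real (i + 1) * sqrt (i + 2))"
proof -
  have "sqrt (i + 2) * (real (i + 1) * chi_const i) \<le> chi_const (i + 3)"
    using chi_const_Suc_ge[of "Suc i"] chi_const_Suc_Suc[of i] by (simp add: numeral_eq_Suc)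
  then show ?thesis by (simp add: divide_simps mult_ac)
qed

lemma nn_integral_gaussian_derivative_tail:
  fixes k t :: real
  assumes "k > 0" "t \<ge> 0"
  shows "(\<integral>\<^sup>+x. ennreal (x * exp (- (k * x\<^sup>2 / 2))) * indicator {t..} x \<partial>lborel)
      = ennreal (exp (- (k * t\<^sup>2 / 2)) / k)"
proof -
  have "(\<integral>\<^sup>+x. ennreal (x * exp (- (k * x\<^sup>2 / 2))) * indicator {t..} x \<partial>lborel)
      = ennreal (0 - (- exp (- (k * t\<^sup>2 / 2)) / k))"
  proof (rule nn_integral_FTC_atLeast[where F="\<lambda>x. - exp (- (k * x\<^sup>2 / 2)) / k"])
    show "((\<lambda>x. - exp (- (k * x\<^sup>2 / 2)) / k) \<longlongrightarrow> 0) at_top"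
      using assms by real_asymp
    show "((\<lambda>x. - exp (- (k * x\<^sup>2 / 2)) / k) has_real_derivative x * exp (- (k * x\<^sup>2 / 2))) (at x)" for x
      using assms by (auto intro!: derivative_eq_intros simp: power2_eq_square)
  qed (use assms in auto)
  then show ?thesis by simp
qed

lemma std_normal_tail_le:
  assumes "t > 0"
  shows "(\<integral>\<^sup>+a. of_bool (t \<le> a) \<partial>std_normal_distribution) \<le> ennreal (exp (- t\<^sup>2 / 2) / (sqrt (2 * pi) * t))"
proof -
  have "(\<integral>\<^sup>+a. of_bool (t \<le> a) \<partial>std_normal_distribution)
      = (\<integral>\<^sup>+a. ennreal (std_normal_density a) * of_bool (t \<le> a) \<partial>lborel)"
    by (rule nn_integral_std_normal) measurable
  also have "\<dots> \<le> (\<integral>\<^sup>+a. ennreal (1 / (sqrt (2 * pi) * t)) * (ennreal (a * exp (- (1 * a\<^sup>2 / 2)))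
      * indicator {t..} a) \<partial>lborel)"
    using assms
    by (intro nn_integral_mono)
      (auto simp: std_normal_density_def indicator_def divide_simps ennreal_mult'[symmetric]
        intro!: ennreal_leI)
  also have "\<dots> = ennreal (1 / (sqrt (2 * pi) * t)) * ennreal (exp (- (1 * t\<^sup>2 / 2)) / 1)"
    using assms by (subst nn_integral_cmult, measurable, subst nn_integral_gaussian_derivative_tail) auto
  finally show ?thesis using assms by (simp add: ennreal_mult'[symmetric])
qed

text \<open>Inflating the integrand by \<open>(v / w)\<^sup>2 \<ge> 1\<close> makes the integral elementary.\<close>
lemma nn_integral_std_normal_tail_le:
  fixes w r :: real
  assumes "w > 0" "r > 0"
  shows "(\<integral>\<^sup>+v. of_bool (w < v) * (\<integral>\<^sup>+a. of_bool (v * r \<le> a) \<partial>std_normal_distribution) \<partial>lborel)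
    \<le> ennreal (1 / (sqrt (2 * pi) * w\<^sup>2)) * ennreal (exp (- (w * r)\<^sup>2 / 2) / r ^ 3)"
proof -
  let ?c = "1 / (sqrt (2 * pi) * w\<^sup>2 * r)"
  have "of_bool (w < v) * (\<integral>\<^sup>+a. of_bool (v * r \<le> a) \<partial>std_normal_distribution)
      \<le> ennreal ?c * (ennreal (v * exp (- (r\<^sup>2 * v\<^sup>2 / 2))) * indicator {w..} v)" for v
  proof (cases "w < v")
    case True
    have "(\<integral>\<^sup>+a. of_bool (v * r \<le> a) \<partial>std_normal_distribution)
        \<le> ennreal (exp (- (v * r)\<^sup>2 / 2) / (sqrt (2 * pi) * (v * r)))"
      using assms True by (intro std_normal_tail_le) auto
    also have "\<dots> \<le> ennreal (?c * (v * exp (- (r\<^sup>2 * v\<^sup>2 / 2))))"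
    proof (rule ennreal_leI)
      have "1 / v \<le> v / w\<^sup>2" using assms True by (simp add: divide_simps power2_eq_square mult_mono)
      then have "1 / v * (exp (- (v * r)\<^sup>2 / 2) / (sqrt (2 * pi) * r))
          \<le> v / w\<^sup>2 * (exp (- (v * r)\<^sup>2 / 2) / (sqrt (2 * pi) * r))"
        using assms by (intro mult_right_mono) auto
      then show "exp (- (v * r)\<^sup>2 / 2) / (sqrt (2 * pi) * (v * r)) \<le> ?c * (v * exp (- (r\<^sup>2 * v\<^sup>2 / 2)))"
        by (simp add: power_mult_distrib mult_ac)
    qed
    finally show ?thesis using True assms by (simp add: ennreal_mult'[symmetric])
  qed simp
  then have "(\<integral>\<^sup>+v. of_bool (w < v) * (\<integral>\<^sup>+a. of_bool (v * r \<le> a) \<partial>std_normal_distribution) \<partial>lborel)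
      \<le> (\<integral>\<^sup>+v. ennreal ?c * (ennreal (v * exp (- (r\<^sup>2 * v\<^sup>2 / 2))) * indicator {w..} v) \<partial>lborel)"
    by (rule nn_integral_mono)
  also have "\<dots> = ennreal ?c * ennreal (exp (- (r\<^sup>2 * w\<^sup>2 / 2)) / r\<^sup>2)"
    using assms by (subst nn_integral_cmult, measurable, subst nn_integral_gaussian_derivative_tail) auto
  also have "\<dots> = ennreal (1 / (sqrt (2 * pi) * w\<^sup>2)) * ennreal (exp (- (w * r)\<^sup>2 / 2) / r ^ 3)"
    using assms by (simp add: ennreal_mult'[symmetric] power2_eq_square power3_eq_cube mult_ac)
  finally show ?thesis .
qed

section \<open>Gaussian measure of circular cones\<close>

definition cone_prob :: "nat \<Rightarrow> real \<Rightarrow> ennreal" where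
  "cone_prob n v = (\<integral>\<^sup>+a. \<integral>\<^sup>+r. of_bool (v * r \<le> a) \<partial>chi n \<partial>std_normal_distribution)"

lemma pair_sigma_finite_chi_std_normal: "pair_sigma_finite (chi n) std_normal_distribution"
  by (intro pair_sigma_finite.intro prob_space_imp_sigma_finite prob_space_chi prob_space_std_normal)

lemma measurable_cone_prob[measurable]: "cone_prob n \<in> borel_measurable borel"
proof -
  interpret pair_sigma_finite "chi n" std_normal_distribution by (rule pair_sigma_finite_chi_std_normal)
  show ?thesis unfolding cone_prob_def by measurable
qed

lemma nn_integral_cone_prob_tail_le:
  assumes "w > 0"
  shows "(\<integral>\<^sup>+v. of_bool (w < v) * cone_prob (i + 4) v \<partial>lborel)
    \<le> ennreal (1 / (sqrt (2 * pi) * w\<^sup>2 * sqrt (1 + w\<^sup>2) ^ Suc i * (real (i + 1) * sqrt (i + 2))))"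
proof -
  interpret X: prob_space "chi (i + 4)" by (rule prob_space_chi)
  interpret XN: pair_sigma_finite "chi (i + 4)" std_normal_distribution
    by (rule pair_sigma_finite_chi_std_normal)
  interpret XL: pair_sigma_finite "chi (i + 4)" lborel ..
  have "(\<integral>\<^sup>+v. of_bool (w < v) * cone_prob (i + 4) v \<partial>lborel)
      = (\<integral>\<^sup>+v. \<integral>\<^sup>+r. of_bool (w < v) * (\<integral>\<^sup>+a. of_bool (v * r \<le> a) \<partial>std_normal_distribution) \<partial>chi
        (i + 4) \<partial>lborel)"
    unfolding cone_prob_def
    by (subst XN.Fubini', measurable) (simp add: nn_integral_cmult[symmetric])
  also have "\<dots> = (\<integral>\<^sup>+r. \<integral>\<^sup>+v. of_bool (w < v) * (\<integral>\<^sup>+a. of_bool (v * r \<le> a) \<partial>std_normal_distribution)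
      \<partial>lborel \<partial>chi (i + 4))"
    by (rule XL.Fubini') measurable
  also have "\<dots> \<le> (\<integral>\<^sup>+r. ennreal (1 / (sqrt (2 * pi) * w\<^sup>2)) * ennreal (exp (- (w
      * r)\<^sup>2 / 2) / r ^ 3) \<partial>chi (i + 4))"
    by (intro nn_integral_mono_AE eventually_mono[OF AE_chi_pos] nn_integral_std_normal_tail_le assms) auto
  also have "\<dots> = ennreal (1 / (sqrt (2 * pi) * w\<^sup>2))
      * ennreal (chi_const i / (chi_const (i + 3) * sqrt (1 + w\<^sup>2) ^ Suc i))"
    using nn_integral_chi_gaussian_tilt[where w=w and k=3 and i=i]
    by (subst nn_integral_cmult) (auto simp: eval_nat_numeral)
  also have "\<dots> = ennreal (1 / (sqrt (2 * pi) * w\<^sup>2 * sqrt (1 + w\<^sup>2) ^ Suc i)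
      * (chi_const i / chi_const (i + 3)))"
    by (simp add: ennreal_mult''[symmetric] less_imp_le mult_ac)
  also have "\<dots> \<le> ennreal (1 / (sqrt (2 * pi) * w\<^sup>2 * sqrt (1 + w\<^sup>2) ^ Suc i) * (1 / (real (i + 1)
      * sqrt (i + 2))))"
    by (intro ennreal_leI mult_left_mono chi_const_ratio_le) simp
  finally show ?thesis by simp
qed

text \<open>The density of the shifted normal variable in \<open>(A + x) / y\<close> is bounded by \<open>y / sqrt (2 \<pi>)\<close>.\<close>
lemma nn_integral_cone_prob_shift_le:
  fixes A w :: real
  assumes "n > 0"
  shows "(\<integral>\<^sup>+x. \<integral>\<^sup>+y. of_bool (w * y < A + x) * cone_prob n ((A + x) / y) \<partial>chi n \<partial>std_normal_distribution)
    \<le> ennreal (sqrt n / sqrt (2 * pi)) * (\<integral>\<^sup>+v. of_bool (w < v) * cone_prob n v \<partial>lborel)"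
proof -
  interpret XN: pair_sigma_finite "chi n" std_normal_distribution by (rule pair_sigma_finite_chi_std_normal)
  define I where "I = (\<integral>\<^sup>+v. of_bool (w < v) * cone_prob n v \<partial>lborel)"
  have slice: "(\<integral>\<^sup>+x. of_bool (w * y < A + x) * cone_prob n ((A + x) / y) \<partial>std_normal_distribution)
      \<le> ennreal y * (ennreal (1 / sqrt (2 * pi)) * I)" if "y > 0" for y
  proof -
    have "(\<integral>\<^sup>+x. of_bool (w * y < A + x) * cone_prob n ((A + x) / y) \<partial>std_normal_distribution)
        = (\<integral>\<^sup>+x. ennreal (std_normal_density x) * (of_bool (w * y < A + x) * cone_prob n
          ((A + x) / y)) \<partial>lborel)"
      by (rule nn_integral_std_normal) measurable
    also have "\<dots> \<le> (\<integral>\<^sup>+x. ennreal (1 / sqrt (2 * pi)) * (of_bool (w * y < A + x) * cone_prob n ((A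
        + x) / y)) \<partial>lborel)"
      by (intro nn_integral_mono mult_right_mono ennreal_leI) (auto
        simp: std_normal_density_def divide_right_mono)
    also have "\<dots> = ennreal y * (\<integral>\<^sup>+v. ennreal (1 / sqrt (2 * pi)) * (of_bool (w < v)
        * cone_prob n v) \<partial>lborel)"
      using that by (subst nn_integral_real_affine[where c=y and t="- A"]) (auto simp: mult.commute[of w])
    also have "\<dots> = ennreal y * (ennreal (1 / sqrt (2 * pi)) * I)"
      unfolding I_def by (subst nn_integral_cmult) auto
    finally show ?thesis .
  qed
  have "(\<integral>\<^sup>+x. \<integral>\<^sup>+y. of_bool (w * y < A + x) * cone_prob n ((A + x) / y) \<partial>chi n \<partial>std_normal_distribution)
      = (\<integral>\<^sup>+y. \<integral>\<^sup>+x. of_bool (w * y < A + x) * cone_prob n ((A + x) / y) \<partial>std_normal_distribution \<partial>chi n)"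
    by (rule XN.Fubini') measurable
  also have "\<dots> \<le> (\<integral>\<^sup>+y. ennreal y * (ennreal (1 / sqrt (2 * pi)) * I) \<partial>chi n)"
    by (intro nn_integral_mono_AE eventually_mono[OF AE_chi_pos[OF assms]] slice)
  also have "\<dots> = (\<integral>\<^sup>+y. ennreal y \<partial>chi n) * (ennreal (1 / sqrt (2 * pi)) * I)"
    by (rule nn_integral_multc) measurable
  also have "\<dots> \<le> ennreal (sqrt n) * (ennreal (1 / sqrt (2 * pi)) * I)"
    by (intro mult_right_mono nn_integral_chi_mean_le) simp
  finally show ?thesis by (simp add: I_def mult.assoc[symmetric] ennreal_mult[symmetric])
qed

lemma cone_prefactor_le: "sqrt (real i + 4) / (2 * pi * (real (i + 1) * sqrt (i + 2))) \<le> 3 / (real i + 5)"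
proof -
  have "sqrt (real i + 4) \<le> sqrt (4 * (real i + 2))" by simp
  then have "sqrt (real i + 4) \<le> 2 * sqrt (real i + 2)" unfolding real_sqrt_mult by simp
  moreover have "4 * (real (i + 1) * sqrt (i + 2)) \<le> 2 * pi * (real (i + 1) * sqrt (i + 2))"
    using pi_ge_two by (intro mult_right_mono) auto
  ultimately have "sqrt (real i + 4) / (2 * pi * (real (i + 1) * sqrt (i + 2)))
      \<le> (2 * sqrt (real i + 2)) / (4 * (real (i + 1) * sqrt (i + 2)))"
    by (intro frac_le) auto
  also have "\<dots> = 1 / (2 * (real i + 1))" by (simp add: divide_simps ac_simps)
  also have "\<dots> \<le> 3 / (real i + 5)" by (simp add: divide_simps)
  finally show ?thesis .
qed

lemma competitor_prob_le:
  fixes A w :: real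
  assumes "w > 0" "n \<ge> 4"
  shows "(\<integral>\<^sup>+x. \<integral>\<^sup>+y. of_bool (w * y < A + x) * cone_prob n ((A + x) / y) \<partial>chi n \<partial>std_normal_distribution)
    \<le> ennreal (3 * (1 + w\<^sup>2)\<^sup>2 / (w\<^sup>2 * real (Suc n) * sqrt (1 + w\<^sup>2) ^ Suc n))"
proof -
  obtain i where n_eq: "n = i + 4" using assms(2) by (metis add.commute le_Suc_ex)
  define s where "s = sqrt (1 + w\<^sup>2)"
  have s_props: "s > 0" "s\<^sup>2 = 1 + w\<^sup>2" by (auto simp: s_def add_pos_nonneg)
  have "(\<integral>\<^sup>+x. \<integral>\<^sup>+y. of_bool (w * y < A + x) * cone_prob n ((A + x) / y) \<partial>chi n \<partial>std_normal_distribution)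
      \<le> ennreal (sqrt n / sqrt (2 * pi)) * (\<integral>\<^sup>+v. of_bool (w < v) * cone_prob n v \<partial>lborel)"
    using assms(2) by (intro nn_integral_cone_prob_shift_le) simp
  also have "\<dots> \<le> ennreal (sqrt n / sqrt (2 * pi))
      * ennreal (1 / (sqrt (2 * pi) * w\<^sup>2 * s ^ Suc i * (real (i + 1) * sqrt (i + 2))))"
    unfolding n_eq s_def by (intro mult_left_mono nn_integral_cone_prob_tail_le assms) auto
  also have "\<dots> = ennreal (1 / (w\<^sup>2 * s ^ Suc i)
      * (sqrt n / (sqrt (2 * pi) * sqrt (2 * pi) * (real (i + 1) * sqrt (i + 2)))))"
    using s_props(1) by (subst ennreal_mult[symmetric]) (auto simp: mult_ac simp del: real_sqrt_mult_self)
  also have "\<dots> \<le> ennreal (1 / (w\<^sup>2 * s ^ Suc i) * (3 / (real i + 5)))"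
    using s_props(1) cone_prefactor_le[of i] by (intro ennreal_leI mult_left_mono) (auto simp: n_eq)
  also have "1 / (w\<^sup>2 * s ^ Suc i) * (3 / (real i + 5))
      = 3 * (1 + w\<^sup>2)\<^sup>2 / (w\<^sup>2 * real (Suc n) * s ^ Suc n)"
  proof -
    have "s ^ Suc n = s ^ Suc i * (1 + w\<^sup>2)\<^sup>2"
      unfolding n_eq s_props(2)[symmetric] power_mult[symmetric] power_add[symmetric] by simp
    moreover have "(1 + w\<^sup>2)\<^sup>2 \<noteq> 0" using s_props by (metis power_not_zero less_irrefl)
    ultimately show ?thesis by (simp add: n_eq add.commute)
  qed
  finally show ?thesis unfolding s_def .
qed

section \<open>Normal approximation of the chi distribution\<close>

definition ln_remainder :: "real \<Rightarrow> real" where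
  "ln_remainder y = ln (1 + y) - y + y\<^sup>2 / 2"

lemma ln_remainder_mono:
  assumes "- 1 < x" "x \<le> y"
  shows "ln_remainder x \<le> ln_remainder y"
  unfolding ln_remainder_def
proof (rule DERIV_nonneg_imp_nondecreasing[OF assms(2)], intro exI conjI)
  fix t assume t_range: "x \<le> t" "t \<le> y"
  show "((\<lambda>t. ln (1 + t) - t + t\<^sup>2 / 2) has_real_derivative (t\<^sup>2 / (1 + t))) (at t)"
    using t_range assms by (auto intro!: derivative_eq_intros simp: field_simps power2_eq_square)
  show "0 \<le> t\<^sup>2 / (1 + t)" using t_range assms by simp
qed

lemma cubic_minus_ln_remainder_mono:
  assumes "- (1 / 2) \<le> x" "x \<le> y"
  shows "2 / 3 * x ^ 3 - ln_remainder x \<le> 2 / 3 * y ^ 3 - ln_remainder y"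
  unfolding ln_remainder_def
proof (rule DERIV_nonneg_imp_nondecreasing[OF assms(2)], intro exI conjI)
  fix t assume t_range: "x \<le> t" "t \<le> y"
  show "((\<lambda>t. 2 / 3 * t ^ 3 - (ln (1 + t) - t + t\<^sup>2 / 2)) has_real_derivative (2 * t\<^sup>2 - t\<^sup>2 / (1
      + t))) (at t)"
    using t_range assms by (auto intro!: derivative_eq_intros simp: field_simps power2_eq_square)
  have "t\<^sup>2 / (1 + t) \<le> t\<^sup>2 / (1 / 2)" using t_range assms by (intro divide_left_mono) auto
  then show "0 \<le> 2 * t\<^sup>2 - t\<^sup>2 / (1 + t)" by simp
qed

lemma ln_remainder_nonpos: "- 1 < y \<Longrightarrow> y \<le> 0 \<Longrightarrow> ln_remainder y \<le> 0"
  using ln_remainder_mono[of y 0] by (simp add: ln_remainder_def)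

lemma abs_ln_remainder_le:
  assumes "- (1 / 2) \<le> y"
  shows "\<bar>ln_remainder y\<bar> \<le> 2 / 3 * \<bar>y\<bar> ^ 3"
proof (cases "y \<ge> 0")
  case True
  then show ?thesis
    using ln_remainder_mono[of 0 y] cubic_minus_ln_remainder_mono[of 0 y] by (simp add: ln_remainder_def)
next
  case False
  then have "\<bar>y\<bar> ^ 3 = - (y ^ 3)" by (simp add: power3_eq_cube)
  then show ?thesis
    using ln_remainder_nonpos[of y] cubic_minus_ln_remainder_mono[of y 0] False assms
    by (simp add: ln_remainder_def)
qed

text \<open>The weight has its mode at \<open>m = sqrt j\<close>.\<close>
lemma chi_weight_div_mode:
  fixes m r :: real
  assumes mode: "m > 0" "m\<^sup>2 = real j" and r_pos: "r > 0"
  shows "chi_weight j r / chi_weight j m = exp (- (r - m)\<^sup>2) * exp (m\<^sup>2 * ln_remainder (r / m - 1))"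
proof -
  have weight: "chi_weight j x = exp (m\<^sup>2 * ln x - x\<^sup>2 / 2)" if "x > 0" for x
  proof -
    have "exp (real j * ln x + (- x\<^sup>2 / 2)) = x ^ j * exp (- x\<^sup>2 / 2)"
      unfolding exp_add using that by (simp add: exp_of_nat_mult)
    then show ?thesis using that by (simp add: chi_weight_def mode(2))
  qed
  define y where "y = r / m - 1"
  have r_eq: "r = m * (1 + y)" using mode by (simp add: y_def)
  have "ln r - ln m = ln (1 + y)" unfolding y_def using r_pos mode by (simp add: ln_div)
  then have "m\<^sup>2 * ln r - r\<^sup>2 / 2 - (m\<^sup>2 * ln m - m\<^sup>2 / 2) = - (r - m)\<^sup>2 + m\<^sup>2 * ln_remainder y"
    by (simp add: ln_remainder_def r_eq power2_eq_square algebra_simps)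
  then show ?thesis
    unfolding weight[OF r_pos] weight[OF mode(1)] exp_diff[symmetric] exp_add[symmetric] y_def by simp
qed

lemma exp_mult_ln_remainder_le:
  assumes "k \<ge> 0" "y \<ge> 0"
  shows "exp (k * ln_remainder y) \<le> 1 + k * y ^ 3 * exp (k * (y\<^sup>2 / 2))"
proof -
  define e where "e = k * ln_remainder y"
  have "ln_remainder y \<le> y ^ 3" using abs_ln_remainder_le[of y] assms(2) by (simp add: abs_le_iff)
  then have cubic: "e \<le> k * y ^ 3" unfolding e_def using assms(1) by (rule mult_left_mono)
  have "ln_remainder y \<le> y\<^sup>2 / 2"
    using ln_add_one_self_le_self2[of y] assms(2) by (simp add: ln_remainder_def)
  then have quadratic: "e \<le> k * (y\<^sup>2 / 2)" unfolding e_def using assms(1) by (rule mult_left_mono)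
  have "exp e \<le> 1 + e * exp e"
    using exp_ge_add_one_self[of "- e"] by (simp add: exp_minus field_simps)
  also have "e * exp e \<le> k * y ^ 3 * exp (k * (y\<^sup>2 / 2))"
    using cubic quadratic assms by (intro mult_mono) auto
  finally show ?thesis by (simp add: e_def)
qed

lemma chi_weight_div_mode_le:
  fixes m r :: real
  assumes mode: "m > 0" "m\<^sup>2 = real j"
  shows "chi_weight j r / chi_weight j m \<le> exp (- (r - m)\<^sup>2) + \<bar>r - m\<bar> ^ 3 / m * exp (- (r - m)\<^sup>2 / 2)"
proof -
  define y where "y = r / m - 1"
  have r_m: "r - m = m * y" using mode by (simp add: y_def field_simps)
  have error_nonneg: "0 \<le> \<bar>r - m\<bar> ^ 3 / m * exp (- (r - m)\<^sup>2 / 2)" using mode by simp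
  consider (above_mode) "r \<ge> m" | (below_mode) "0 < r" "r < m" | (nonpositive) "r \<le> 0" by linarith
  then show ?thesis
  proof cases
    case above_mode
    then have y_nonneg: "y \<ge> 0" using mode by (simp add: y_def)
    have "chi_weight j r / chi_weight j m = exp (- (r - m)\<^sup>2) * exp (m\<^sup>2 * ln_remainder y)"
      unfolding y_def using above_mode mode by (intro chi_weight_div_mode) auto
    also have "\<dots> \<le> exp (- (r - m)\<^sup>2) * (1 + m\<^sup>2 * y ^ 3 * exp (m\<^sup>2 * (y\<^sup>2 / 2)))"
      using y_nonneg by (intro mult_left_mono exp_mult_ln_remainder_le) auto
    also have "\<dots> = exp (- (r - m)\<^sup>2) + m\<^sup>2 * y ^ 3 * exp (- (r - m)\<^sup>2 + m\<^sup>2 * (y\<^sup>2 / 2))"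
      unfolding exp_add by (simp add: algebra_simps)
    also have "- (r - m)\<^sup>2 + m\<^sup>2 * (y\<^sup>2 / 2) = - (r - m)\<^sup>2 / 2" by (simp add: r_m power_mult_distrib)
    also have "m\<^sup>2 * y ^ 3 = \<bar>r - m\<bar> ^ 3 / m"
      using mode(1) y_nonneg
      unfolding r_m by (simp add: abs_mult power_mult_distrib power2_eq_square power3_eq_cube)
    finally show ?thesis .
  next
    case below_mode
    then have "ln_remainder y \<le> 0" using mode by (intro ln_remainder_nonpos) (auto simp: y_def)
    then have "exp (- (r - m)\<^sup>2) * exp (m\<^sup>2 * ln_remainder y) \<le> exp (- (r - m)\<^sup>2) * 1"
      by (intro mult_left_mono) (auto simp: mult_nonneg_nonpos)
    then show ?thesis
      using error_nonneg unfolding chi_weight_div_mode[OF mode below_mode(1)] y_def by linarith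
  next
    case nonpositive
    then have "chi_weight j r = 0" by (simp add: chi_weight_def)
    then show ?thesis using error_nonneg by simp
  qed
qed

text \<open>To the left of \<open>m / 2\<close> the lower bound is trivial, the factor \<open>4\<close> making it nonpositive.\<close>
lemma chi_weight_div_mode_ge:
  fixes m r :: real
  assumes mode: "m > 0" "m\<^sup>2 = real j" and j_ge_2: "j \<ge> 2"
  shows "exp (- (r - m)\<^sup>2) * (1 - 4 * \<bar>r - m\<bar> ^ 3 / m) \<le> chi_weight j r / chi_weight j m"
proof (cases "r \<ge> m / 2")
  case True
  then have r_pos: "r > 0" using mode by linarith
  define y where "y = r / m - 1"
  have "\<bar>r - m\<bar> = m * \<bar>y\<bar>" using mode by (simp add: y_def abs_mult_pos' right_diff_distrib)
  then have cube: "4 * \<bar>r - m\<bar> ^ 3 / m = m\<^sup>2 * (4 * \<bar>y\<bar> ^ 3)"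
    using mode(1) by (simp add: power_mult_distrib power2_eq_square power3_eq_cube)
  have "\<bar>ln_remainder y\<bar> \<le> 2 / 3 * \<bar>y\<bar> ^ 3"
    using True mode by (intro abs_ln_remainder_le) (simp add: y_def field_simps)
  moreover have "2 / 3 * \<bar>y\<bar> ^ 3 \<le> 4 * \<bar>y\<bar> ^ 3" by (intro mult_right_mono) auto
  ultimately have "m\<^sup>2 * - (4 * \<bar>y\<bar> ^ 3) \<le> m\<^sup>2 * ln_remainder y" by (intro mult_left_mono) auto
  then have "1 - 4 * \<bar>r - m\<bar> ^ 3 / m \<le> exp (m\<^sup>2 * ln_remainder y)"
    using exp_ge_add_one_self[of "m\<^sup>2 * ln_remainder y"] unfolding cube by linarith
  then show ?thesis
    unfolding chi_weight_div_mode[OF mode r_pos] y_def by (intro mult_left_mono) auto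
next
  case False
  then have "(m / 2) ^ 3 \<le> \<bar>r - m\<bar> ^ 3" using mode by (intro power_mono) auto
  then have "4 * (m / 2) ^ 3 / m \<le> 4 * \<bar>r - m\<bar> ^ 3 / m" using mode by (intro divide_right_mono) auto
  moreover have "4 * (m / 2) ^ 3 / m = m\<^sup>2 / 2" using mode by (simp add: power3_eq_cube power2_eq_square)
  moreover have "m\<^sup>2 \<ge> 2" using j_ge_2 mode(2) by simp
  ultimately have "exp (- (r - m)\<^sup>2) * (1 - 4 * \<bar>r - m\<bar> ^ 3 / m) \<le> 0"
    by (intro mult_nonneg_nonpos) auto
  also have "0 \<le> chi_weight j r / chi_weight j m" by simp
  finally show ?thesis .
qed

lemma normal_density_inverse_sqrt2: "normal_density m (1 / sqrt 2) r = exp (- (r - m)\<^sup>2) / sqrt pi"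
  by (simp add: normal_density_def power_divide)

lemma chi_const_div_mode_le:
  fixes m :: real
  assumes mode: "m > 0" "m\<^sup>2 = real j"
  shows "chi_const j / chi_weight j m \<le> sqrt pi * (1 + 4 / m)"
proof -
  let ?B = "\<lambda>r. sqrt pi * normal_density m (1 / sqrt 2) r + sqrt (2 * pi) / m
      * (normal_density m 1 r * \<bar>r - m\<bar> ^ 3)"
  have moment: "has_bochner_integral lborel (\<lambda>r. normal_density m 1 r * \<bar>r - m\<bar> ^ 3) (2 * sqrt (2 / pi))"
    using normal_moment_abs_odd[of 1 m 1] by (simp add: numeral_3_eq_3)
  have majorant_integral: "has_bochner_integral lborel ?B (sqrt pi * 1 + sqrt (2 * pi) / m * (2
      * sqrt (2 / pi)))"
    by (intro has_bochner_integral_add has_bochner_integral_mult_right moment)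
      (simp add: has_bochner_integral_iff)
  have "chi_const j / chi_weight j m = (\<integral>r. chi_weight j r / chi_weight j m \<partial>lborel)"
    by (simp add: chi_const_def)
  also have "\<dots> \<le> (\<integral>r. ?B r \<partial>lborel)"
  proof (rule integral_mono)
    show "integrable lborel ?B" using majorant_integral by (rule integrable.intros)
    fix r
    have "?B r = exp (- (r - m)\<^sup>2) + \<bar>r - m\<bar> ^ 3 / m * exp (- (r - m)\<^sup>2 / 2)"
      unfolding normal_density_inverse_sqrt2 by (simp add: normal_density_def)
    then show "chi_weight j r / chi_weight j m \<le> ?B r" using chi_weight_div_mode_le[OF mode] by simp
  qed simp
  also have "\<dots> = sqrt pi + (sqrt (2 * pi) * sqrt (2 / pi)) * (2 / m)"
    using majorant_integral by (simp add: has_bochner_integral_iff mult_ac)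
  also have "sqrt (2 * pi) * sqrt (2 / pi) = 2" by (simp add: real_sqrt_mult[symmetric])
  also have "sqrt pi + 2 * (2 / m) \<le> sqrt pi * (1 + 4 / m)"
    using mult_right_mono[of 1 "sqrt pi" "4 / m"] mode pi_ge_two by (simp add: algebra_simps)
  finally show ?thesis .
qed

lemma one_minus_minus_le_divide:
  fixes d k :: real
  assumes "0 \<le> d" "d \<le> 1" "0 \<le> k"
  shows "1 - d - k \<le> (1 - d) / (1 + k)"
proof -
  have "(1 - d - k) * (1 + k) = 1 - d - d * k - k * k" by (simp add: algebra_simps)
  also have "\<dots> \<le> 1 - d"
    using mult_nonneg_nonneg[OF assms(1,3)] mult_nonneg_nonneg[OF assms(3,3)] by linarith
  finally show ?thesis using assms by (simp add: pos_le_divide_eq)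
qed

lemma chi_density_ge_normal:
  fixes m :: real
  assumes mode: "m > 0" "m\<^sup>2 = real j" and j_ge_2: "j \<ge> 2"
  shows "normal_density m (1 / sqrt 2) r * (1 - (4 * \<bar>r - m\<bar> ^ 3 + 4) / m) \<le> chi_weight j r / chi_const j"
proof -
  define d where "d = 4 * \<bar>r - m\<bar> ^ 3 / m"
  define C where "C = chi_const j / chi_weight j m"
  have weight_pos: "chi_weight j m > 0" using mode by (simp add: chi_weight_def)
  then have C_bounds: "C > 0" "C \<le> sqrt pi * (1 + 4 / m)"
    unfolding C_def using chi_const_div_mode_le[OF mode] by auto
  have d_nonneg: "d \<ge> 0" and four_div_m_nonneg: "4 / m \<ge> 0" unfolding d_def using mode by auto
  have gap: "1 - (4 * \<bar>r - m\<bar> ^ 3 + 4) / m = 1 - d - 4 / m" by (simp add: d_def add_divide_distrib)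
  show ?thesis
  proof (cases "d \<le> 1")
    case True
    then have "normal_density m (1 / sqrt 2) r * (1 - d - 4 / m)
        \<le> normal_density m (1 / sqrt 2) r * ((1 - d) / (1 + 4 / m))"
      using d_nonneg four_div_m_nonneg by (intro mult_left_mono one_minus_minus_le_divide) auto
    also have "\<dots> = exp (- (r - m)\<^sup>2) * (1 - d) / (sqrt pi * (1 + 4 / m))"
      by (simp add: normal_density_inverse_sqrt2)
    also have "\<dots> \<le> exp (- (r - m)\<^sup>2) * (1 - d) / C"
      using C_bounds True by (intro divide_left_mono) (auto intro!: mult_pos_pos add_pos_pos mode(1))
    also have "\<dots> \<le> (chi_weight j r / chi_weight j m) / C"
      unfolding d_def
      using chi_weight_div_mode_ge[OF mode j_ge_2] C_bounds by (intro divide_right_mono) auto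
    also have "\<dots> = chi_weight j r / chi_const j" using weight_pos by (simp add: C_def)
    finally show ?thesis unfolding gap .
  next
    case False
    then have "1 - d - 4 / m \<le> 0" using four_div_m_nonneg by linarith
    then have "normal_density m (1 / sqrt 2) r * (1 - d - 4 / m) \<le> 0"
      by (intro mult_nonneg_nonpos) auto
    also have "0 \<le> chi_weight j r / chi_const j" by (simp add: less_imp_le)
    finally show ?thesis unfolding gap .
  qed
qed

lemma integral_normal_cubic_gap_le:
  fixes m :: real
  assumes "m > 0"
  defines "e \<equiv> \<lambda>r. normal_density m (1 / sqrt 2) r * ((4 * \<bar>r - m\<bar> ^ 3 + 4) / m)"
  shows "integrable lborel e" "(\<integral>r. e r \<partial>lborel) \<le> 12 / m"
proof -
  let ?g = "normal_density m (1 / sqrt 2)"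
  have "has_bochner_integral lborel (\<lambda>r. ?g r * \<bar>r - m\<bar> ^ 3) (2 * (1 / sqrt 2) ^ 3 * sqrt (2 / pi))"
    using normal_moment_abs_odd[of "1 / sqrt 2" m 1] by (simp add: numeral_3_eq_3)
  moreover have "has_bochner_integral lborel ?g 1" by (simp add: has_bochner_integral_iff)
  ultimately have "has_bochner_integral lborel (\<lambda>r. 4 / m * (?g r * \<bar>r - m\<bar> ^ 3) + 4 / m * ?g r)
      (4 / m * (2 * (1 / sqrt 2) ^ 3 * sqrt (2 / pi)) + 4 / m * 1)"
    by (intro has_bochner_integral_add has_bochner_integral_mult_right)
  then have e_integral: "has_bochner_integral lborel e (4 / m * (2 * (1 / sqrt 2) ^ 3
      * sqrt (2 / pi)) + 4 / m * 1)"
    by (simp add: e_def algebra_simps add_divide_distrib)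
  show "integrable lborel e" using e_integral by (rule integrable.intros)
  have "(1 / sqrt 2) ^ 3 * sqrt (2 / pi) \<le> (1::real) * 1"
    using pi_ge_two by (intro mult_mono power_le_one) auto
  then have "4 / m * (2 * ((1 / sqrt 2) ^ 3 * sqrt (2 / pi))) \<le> 4 / m * (2 * 1)"
    using assms(1) by (intro mult_left_mono) auto
  then show "(\<integral>r. e r \<partial>lborel) \<le> 12 / m"
    using has_bochner_integral_integral_eq[OF e_integral] by (simp add: mult.assoc)
qed

lemma nn_integral_chi_le_normal:
  fixes h :: "real \<Rightarrow> real"
  assumes j_ge_2: "j \<ge> 2" and [measurable]: "h \<in> borel_measurable borel"
    and h_range: "\<And>r. 0 \<le> h r" "\<And>r. h r \<le> 1"
  shows "(\<integral>\<^sup>+r. ennreal (h r) \<partial>chi (Suc j))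
    \<le> (\<integral>\<^sup>+r. ennreal (h r) \<partial>normal_distribution (sqrt j) (1 / sqrt 2)) + ennreal (12 / sqrt j)"
proof -
  define m where "m = sqrt j"
  have mode: "m > 0" "m\<^sup>2 = real j" using j_ge_2 by (auto simp: m_def)
  let ?f = "\<lambda>r. chi_weight j r / chi_const j" and ?g = "normal_density m (1 / sqrt 2)"
  let ?e = "\<lambda>r. ?g r * ((4 * \<bar>r - m\<bar> ^ 3 + 4) / m)"
  have mult_h_integrable: "integrable lborel (\<lambda>r. k r * h r)"
    if "integrable lborel k" for k :: "real \<Rightarrow> real"
    using that h_range
    by (intro Bochner_Integration.integrable_bound[OF that]) (auto simp: abs_mult mult_left_le)
  have "(\<integral>\<^sup>+r. ennreal (h r) \<partial>chi (Suc j)) = (\<integral>\<^sup>+r. ennreal (?f r * h r) \<partial>lborel)"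
    unfolding chi_Suc_eq_density
    by (subst nn_integral_density) (auto simp: h_range less_imp_le ennreal_mult'[symmetric])
  also have "\<dots> = ennreal (\<integral>r. ?f r * h r \<partial>lborel)"
    by (intro nn_integral_eq_integral mult_h_integrable) (auto simp: h_range less_imp_le)
  also have "\<dots> \<le> ennreal ((\<integral>r. ?g r * h r \<partial>lborel) + (\<integral>r. ?e r \<partial>lborel))"
  proof (intro ennreal_leI integral_mult_le_of_density_gap h_range)
    show "integrable lborel ?e" by (rule integral_normal_cubic_gap_le(1)[OF mode(1)])
    show "(\<integral>r. ?f r \<partial>lborel) = (\<integral>r. ?g r \<partial>lborel)"
      using chi_const_pos[of j] by (simp add: chi_const_def[symmetric] del: chi_const_pos)
    show "?g r - ?f r \<le> ?e r" for r
      using chi_density_ge_normal[OF mode j_ge_2, of r] by (simp add: algebra_simps)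
  qed (use mode in auto)
  also have "\<dots> \<le> ennreal (\<integral>r. ?g r * h r \<partial>lborel) + ennreal (12 / m)"
    using integral_normal_cubic_gap_le(2)[OF mode(1)] mode
    by (subst ennreal_plus[symmetric]) (auto intro!: ennreal_leI integral_nonneg_AE simp: h_range)
  also have "ennreal (\<integral>r. ?g r * h r \<partial>lborel) = (\<integral>\<^sup>+r. ennreal (?g r * h r) \<partial>lborel)"
    by (intro nn_integral_eq_integral[symmetric] mult_h_integrable) (auto simp: h_range)
  also have "\<dots> = (\<integral>\<^sup>+r. ennreal (h r) \<partial>normal_distribution m (1 / sqrt 2))"
    by (subst nn_integral_density) (auto simp: h_range ennreal_mult'[symmetric])
  finally show ?thesis unfolding m_def .
qed

section \<open>The standard normal distribution function\<close>

lemma Phi_has_real_derivative: "(Phi has_real_derivative std_normal_density t) (at t)"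
proof -
  have integrable: "interval_lebesgue_integrable lborel a b std_normal_density" for a b
    unfolding interval_lebesgue_integrable_def set_integrable_def
    by (cases "a \<le> b") (simp_all only: if_True if_False, (rule integrable_mult_indicator; simp)+)
  have Phi_eq: "Phi = (\<lambda>u. Phi 0 + (LBINT s=ereal 0..ereal u. std_normal_density s))"
  proof
    fix u
    have density: "std_normal_density = (\<lambda>s. 1 / sqrt (2 * pi) * exp (- (s^2) / 2))"
      by (simp add: std_normal_density_def fun_eq_iff)
    show "Phi u = Phi 0 + (LBINT s=ereal 0..ereal u. std_normal_density s)"
      unfolding Phi_def using interval_integral_sum[OF integrable, of "-\<infinity>" "ereal 0" "ereal u"]
      by (simp add: density)
  qed
  let ?I = "{- \<bar>t\<bar> - 1..\<bar>t\<bar> + 1}"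
  have "((\<lambda>u. LBINT s=ereal 0..ereal u. std_normal_density s)
      has_vector_derivative std_normal_density t) (at t within ?I)"
    by (rule interval_integral_FTC2) (auto intro!: continuous_intros simp: std_normal_density_def)
  then have "((\<lambda>u. LBINT s=ereal 0..ereal u. std_normal_density s)
      has_real_derivative std_normal_density t) (at t)"
    by (simp add: has_real_derivative_iff_has_vector_derivative at_within_Icc_at)
  then show ?thesis
    by (subst Phi_eq) (auto intro!: derivative_eq_intros)
qed

lemma isCont_Phi: "isCont Phi t"
  using Phi_has_real_derivative by (rule DERIV_isCont)

lemma measurable_Phi[measurable]: "Phi \<in> borel_measurable borel"
  by (intro borel_measurable_continuous_onI continuous_at_imp_continuous_on ballI isCont_Phi)

lemma Phi_strict_mono: "x < y \<Longrightarrow> Phi x < Phi y"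
  by (rule DERIV_pos_imp_increasing[where f=Phi])
    (auto intro!: exI[of _ "std_normal_density _"] Phi_has_real_derivative normal_density_pos)

lemma Phi_mono: "x \<le> y \<Longrightarrow> Phi x \<le> Phi y"
  using Phi_strict_mono[of x y] by (cases "x = y") (auto simp: less_imp_le)

lemma Phi_eq_cdf: "Phi t = cdf std_normal_distribution t"
proof -
  have "cdf std_normal_distribution t = (\<integral>x. indicator {..t} x \<partial>std_normal_distribution)"
    by (simp add: cdf_def)
  also have "\<dots> = (\<integral>x. std_normal_density x * indicator {..t} x \<partial>lborel)"
    by (rule integral_real_density) auto
  also have "\<dots> = (\<integral>x. indicator {..<t} x *\<^sub>R (1 / sqrt (2 * pi) * exp (- (x^2) / 2)) \<partial>lborel)"
  proof (rule integral_cong_AE)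
    show "AE x in lborel. std_normal_density x * indicator {..t} x
        = indicator {..<t} x *\<^sub>R (1 / sqrt (2 * pi) * exp (- (x^2) / 2))"
      using AE_lborel_singleton[of t] by eventually_elim (auto simp: std_normal_density_def indicator_def)
  qed auto
  also have "\<dots> = Phi t"
    unfolding Phi_def interval_lebesgue_integral_def set_lebesgue_integral_def by simp
  finally show ?thesis by simp
qed

lemma Phi_nonneg: "0 \<le> Phi t" and Phi_le_1: "Phi t \<le> 1"
proof -
  interpret N: prob_space std_normal_distribution by (rule prob_space_std_normal)
  show "0 \<le> Phi t" "Phi t \<le> 1" by (auto simp: Phi_eq_cdf cdf_def)
qed

lemma nn_integral_std_normal_atMost: "(\<integral>\<^sup>+x. of_bool (x \<le> t) \<partial>std_normal_distribution) = ennreal (Phi t)"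
proof -
  interpret N: prob_space std_normal_distribution by (rule prob_space_std_normal)
  have "(\<integral>\<^sup>+x. of_bool (x \<le> t) \<partial>std_normal_distribution)
      = (\<integral>\<^sup>+x. indicator {..t} x \<partial>std_normal_distribution)"
    by (intro nn_integral_cong) (auto simp: indicator_def)
  then show ?thesis by (simp add: Phi_eq_cdf cdf_def N.emeasure_eq_measure)
qed

lemma Phi_Phi_inv:
  assumes "0 < p" "p < 1"
  shows "Phi (Phi_inv p) = p"
proof -
  interpret real_distribution std_normal_distribution by (rule real_dist_normal_dist)
  have cdf_eq: "cdf std_normal_distribution = Phi" by (rule ext) (rule Phi_eq_cdf[symmetric])
  have "eventually (\<lambda>t. Phi t < p) at_bot"
    using order_tendstoD(2)[OF cdf_lim_at_bot, of p] assms by (simp add: cdf_eq)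
  then obtain a where Phi_a: "Phi a < p" by (auto simp: eventually_at_bot_linorder)
  have "eventually (\<lambda>t. p < Phi t) at_top"
    using order_tendstoD(1)[OF cdf_lim_at_top_prob, of p] assms by (simp add: cdf_eq)
  then obtain b where Phi_b: "p < Phi b" by (auto simp: eventually_at_top_linorder)
  have "a \<le> b" using Phi_a Phi_b Phi_mono[of b a] by linarith
  then obtain t where Phi_t: "Phi t = p"
    using IVT[of Phi a p b] Phi_a Phi_b isCont_Phi by (metis less_imp_le)
  moreover have "u = t" if "Phi u = p" for u
    using Phi_strict_mono[of u t] Phi_strict_mono[of t u] that Phi_t
    by (cases u t rule: linorder_cases) auto
  ultimately have "Phi_inv p = t" unfolding Phi_inv_def by (intro the_equality)
  with Phi_t show ?thesis by simp
qed

lemma nn_integral_Phi_affine: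
  "(\<integral>\<^sup>+b. ennreal (Phi (\<alpha> + \<beta> * b)) \<partial>std_normal_distribution) = ennreal (Phi (\<alpha> / sqrt (1 + \<beta>\<^sup>2)))"
proof -
  interpret N: prob_space std_normal_distribution by (rule prob_space_std_normal)
  interpret NN: pair_sigma_finite std_normal_distribution std_normal_distribution ..
  have sqrt_pos: "sqrt (1 + \<beta>\<^sup>2) > 0" by (simp add: add_pos_nonneg)
  have "(\<integral>\<^sup>+b. ennreal (Phi (\<alpha> + \<beta> * b)) \<partial>std_normal_distribution)
      = (\<integral>\<^sup>+b. \<integral>\<^sup>+a. of_bool (a \<le> \<alpha> + \<beta> * b) \<partial>std_normal_distribution \<partial>std_normal_distribution)"
    by (simp add: nn_integral_std_normal_atMost)
  also have "\<dots> = (\<integral>\<^sup>+a. \<integral>\<^sup>+b. of_bool (a \<le> \<alpha> + \<beta> * b) \<partial>std_normal_distribution \<partial>std_normal_distribution)"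
    by (rule NN.Fubini') measurable
  also have "\<dots> = (\<integral>\<^sup>+a. \<integral>\<^sup>+b. of_bool (1 * a + - \<beta> * b \<le> \<alpha>) \<partial>std_normal_distribution
      \<partial>std_normal_distribution)"
    by (simp add: diff_le_eq)
  also have "\<dots> = (\<integral>\<^sup>+a. \<integral>\<^sup>+b. of_bool (sqrt (1\<^sup>2 + (- \<beta>)\<^sup>2) * a \<le> \<alpha>) \<partial>std_normal_distribution
      \<partial>std_normal_distribution)"
    by (rule nn_integral_std_normal_linear_norm[of "\<lambda>x _. of_bool (x \<le> \<alpha>)"]) measurable
  also have "\<dots> = (\<integral>\<^sup>+a. of_bool (a \<le> \<alpha> / sqrt (1 + \<beta>\<^sup>2)) \<partial>std_normal_distribution)"
    using sqrt_pos N.emeasure_space_1 by (simp add: pos_le_divide_eq mult.commute)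
  finally show ?thesis by (simp add: nn_integral_std_normal_atMost)
qed

lemma nn_integral_Phi_normal:
  assumes "\<sigma> > 0"
  shows "(\<integral>\<^sup>+r. ennreal (Phi (w * r - A)) \<partial>normal_distribution m \<sigma>)
    = ennreal (Phi ((w * m - A) / sqrt (1 + (w * \<sigma>)\<^sup>2)))"
  using nn_integral_Phi_affine[of "w * m - A" "w * \<sigma>"]
  by (simp add: normal_distribution_eq_distr[OF assms] nn_integral_distr algebra_simps)

lemma nn_integral_std_normal_chi_le_Phi:
  fixes A w :: real
  assumes "j \<ge> 2"
  shows "(\<integral>\<^sup>+x. \<integral>\<^sup>+y. of_bool (A + x \<le> w * y) \<partial>chi (Suc j) \<partial>std_normal_distribution)
    \<le> ennreal (Phi ((w * sqrt j - A) / sqrt (1 + w\<^sup>2 / 2)) + 12 / sqrt j)"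
proof -
  interpret XN: pair_sigma_finite "chi (Suc j)" std_normal_distribution
    by (rule pair_sigma_finite_chi_std_normal)
  have "(\<integral>\<^sup>+x. \<integral>\<^sup>+y. of_bool (A + x \<le> w * y) \<partial>chi (Suc j) \<partial>std_normal_distribution)
      = (\<integral>\<^sup>+y. \<integral>\<^sup>+x. of_bool (A + x \<le> w * y) \<partial>std_normal_distribution \<partial>chi (Suc j))"
    by (rule XN.Fubini') measurable
  also have "\<dots> = (\<integral>\<^sup>+y. \<integral>\<^sup>+x. of_bool (x \<le> w * y - A) \<partial>std_normal_distribution \<partial>chi (Suc j))"
    by (simp add: le_diff_eq add.commute)
  also have "\<dots> = (\<integral>\<^sup>+y. ennreal (Phi (w * y - A)) \<partial>chi (Suc j))"
    by (simp add: nn_integral_std_normal_atMost)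
  also have "\<dots> \<le> (\<integral>\<^sup>+y. ennreal (Phi (w * y - A)) \<partial>normal_distribution (sqrt j) (1 / sqrt 2))
      + ennreal (12 / sqrt j)"
    by (intro nn_integral_chi_le_normal assms Phi_nonneg Phi_le_1) measurable
  also have "\<dots> = ennreal (Phi ((w * sqrt j - A) / sqrt (1 + w\<^sup>2 / 2)) + 12 / sqrt j)"
    by (subst nn_integral_Phi_normal) (auto simp: Phi_nonneg power_divide)
  finally show ?thesis .
qed

section \<open>The random coding union bound\<close>

definition max_score_region :: "('x \<Rightarrow> 'y \<Rightarrow> real) \<Rightarrow> 'y set \<Rightarrow> 'm set \<Rightarrow> ('m \<Rightarrow> 'x) \<Rightarrow> 'm \<Rightarrow> 'y set" where
  "max_score_region s \<Omega> I G m = {y \<in> \<Omega>. \<forall>m'\<in>I - {m}. s (G m') y < s (G m) y}"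

lemma max_score_region_disjoint:
  assumes "m \<in> I" "m' \<in> I" "m \<noteq> m'"
  shows "max_score_region s \<Omega> I G m \<inter> max_score_region s \<Omega> I G m' = {}"
proof (rule equals0I)
  fix y assume "y \<in> max_score_region s \<Omega> I G m \<inter> max_score_region s \<Omega> I G m'"
  then have "s (G m') y < s (G m) y" "s (G m) y < s (G m') y"
    using assms by (auto simp: max_score_region_def)
  then show False by simp
qed

lemma nn_integral_PiM_split_component:
  assumes prob_Q: "prob_space Q" and fin_mem: "finite I" "m \<in> I"
    and f_measurable: "f \<in> borel_measurable (PiM I (\<lambda>_. Q))"
  shows "(\<integral>\<^sup>+G. f G \<partial>PiM I (\<lambda>_. Q)) = (\<integral>\<^sup>+x. \<integral>\<^sup>+G. f (G(m := x)) \<partial>PiM (I - {m}) (\<lambda>_. Q) \<partial>Q)"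
proof -
  interpret Q: prob_space Q by fact
  interpret product_prob_space "\<lambda>_. Q" ..
  have "insert m (I - {m}) = I" using fin_mem(2) by blast
  then show ?thesis using product_nn_integral_insert_rev[of "I - {m}" m f] fin_mem(1) f_measurable by simp
qed

lemma nn_integral_PiM_ex_le:
  assumes prob_Q: "prob_space Q" and "finite J"
    and [measurable]: "Measurable.pred Q p"
  shows "(\<integral>\<^sup>+G. of_bool (\<exists>m\<in>J. p (G m)) \<partial>PiM J (\<lambda>_. Q))
    \<le> min 1 (of_nat (card J) * (\<integral>\<^sup>+x. of_bool (p x) \<partial>Q))"
proof (rule min.boundedI)
  interpret PiM: prob_space "PiM J (\<lambda>_. Q)" by (intro prob_space_PiM prob_Q)
  show "(\<integral>\<^sup>+G. of_bool (\<exists>m\<in>J. p (G m)) \<partial>PiM J (\<lambda>_. Q)) \<le> 1"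
    by (intro PiM.nn_integral_le_const[of 1]) auto
  have "(\<integral>\<^sup>+G. of_bool (\<exists>m\<in>J. p (G m)) \<partial>PiM J (\<lambda>_. Q)) \<le> (\<integral>\<^sup>+G. (\<Sum>m\<in>J. of_bool (p (G m))) \<partial>PiM J (\<lambda>_. Q))"
  proof (rule nn_integral_mono)
    fix G
    show "of_bool (\<exists>m\<in>J. p (G m)) \<le> (\<Sum>m\<in>J. of_bool (p (G m)) :: ennreal)"
    proof (cases "\<exists>m\<in>J. p (G m)")
      case True
      then obtain m where m_witness: "m \<in> J" "p (G m)" by blast
      then have "(1 :: ennreal) = of_bool (p (G m))" by simp
      also have "\<dots> \<le> (\<Sum>m\<in>J. of_bool (p (G m)))"
        using m_witness assms(2) by (intro member_le_sum) auto
      finally show ?thesis using True by simp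
    qed simp
  qed
  also have "\<dots> = (\<Sum>m\<in>J. \<integral>\<^sup>+G. of_bool (p (G m)) \<partial>PiM J (\<lambda>_. Q))"
    by (rule nn_integral_sum) measurable
  also have "\<dots> = of_nat (card J) * (\<integral>\<^sup>+x. of_bool (p x) \<partial>Q)"
    by (simp add: nn_integral_PiM_component[OF prob_Q, where f="\<lambda>x. of_bool (p x)"])
  finally show "(\<integral>\<^sup>+G. of_bool (\<exists>m\<in>J. p (G m)) \<partial>PiM J (\<lambda>_. Q))
    \<le> of_nat (card J) * (\<integral>\<^sup>+x. of_bool (p x) \<partial>Q)" .
qed

lemma nn_integral_PiM_ex_le_Fubini:
  assumes prob_Q: "prob_space Q" and sigma_finite_N: "sigma_finite_measure N" and fin: "finite J"
    and p_pred[measurable]: "Measurable.pred (Q \<Otimes>\<^sub>M N) (case_prod p)"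
  shows "(\<integral>\<^sup>+G. \<integral>\<^sup>+y. of_bool (\<exists>m\<in>J. p (G m) y) \<partial>N \<partial>PiM J (\<lambda>_. Q))
    \<le> (\<integral>\<^sup>+y. min 1 (of_nat (card J) * (\<integral>\<^sup>+x. of_bool (p x y) \<partial>Q)) \<partial>N)"
proof -
  interpret N: sigma_finite_measure N by fact
  interpret PiM: prob_space "PiM J (\<lambda>_. Q)" by (intro prob_space_PiM prob_Q)
  interpret pair_sigma_finite "PiM J (\<lambda>_. Q)" N ..
  have [measurable]: "(\<lambda>G. G m) \<in> PiM J (\<lambda>_. Q) \<rightarrow>\<^sub>M Q" if "m \<in> J" for m
    using that by (rule measurable_component_singleton)
  have "(\<integral>\<^sup>+G. \<integral>\<^sup>+y. of_bool (\<exists>m\<in>J. p (G m) y) \<partial>N \<partial>PiM J (\<lambda>_. Q))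
      = (\<integral>\<^sup>+y. \<integral>\<^sup>+G. of_bool (\<exists>m\<in>J. p (G m) y) \<partial>PiM J (\<lambda>_. Q) \<partial>N)"
    using fin by (intro Fubini'[symmetric]) (unfold split_beta', measurable)
  also have "\<dots> \<le> (\<integral>\<^sup>+y. min 1 (of_nat (card J) * (\<integral>\<^sup>+x. of_bool (p x y) \<partial>Q)) \<partial>N)"
  proof (rule nn_integral_mono)
    fix y assume [measurable]: "y \<in> space N"
    show "(\<integral>\<^sup>+G. of_bool (\<exists>m\<in>J. p (G m) y) \<partial>PiM J (\<lambda>_. Q))
        \<le> min 1 (of_nat (card J) * (\<integral>\<^sup>+x. of_bool (p x y) \<partial>Q))"
      by (intro nn_integral_PiM_ex_le prob_Q fin) measurable
  qed
  finally show ?thesis .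
qed

lemma nn_integral_random_code_error_le:
  fixes K :: "'x \<Rightarrow> 'y measure" and s :: "'x \<Rightarrow> 'y \<Rightarrow> real"
  assumes prob_Q: "prob_space Q" and kernel[measurable]: "K \<in> Q \<rightarrow>\<^sub>M subprob_algebra Y"
    and s_measurable[measurable]: "case_prod s \<in> borel_measurable (Q \<Otimes>\<^sub>M Y)"
    and fin_mem: "finite I" "m \<in> I"
  shows "(\<integral>\<^sup>+G. \<integral>\<^sup>+y. of_bool (\<exists>m'\<in>I - {m}. s (G m) y \<le> s (G m') y) \<partial>K (G m) \<partial>PiM I (\<lambda>_. Q))
    \<le> (\<integral>\<^sup>+x. \<integral>\<^sup>+y. min 1 (of_nat (card I) * (\<integral>\<^sup>+x'. of_bool (s x y \<le> s x' y) \<partial>Q)) \<partial>K x \<partial>Q)"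
proof -
  have [measurable]: "(\<lambda>G. G k) \<in> PiM I (\<lambda>_. Q) \<rightarrow>\<^sub>M Q" if "k \<in> I" for k
    using that by (rule measurable_component_singleton)
  have "(\<lambda>G. \<integral>\<^sup>+y. of_bool (\<exists>m'\<in>I - {m}. s (G m) y \<le> s (G m') y) \<partial>K (G m))
      \<in> borel_measurable (PiM I (\<lambda>_. Q))"
    using fin_mem
    by (intro nn_integral_measurable_subprob_algebra2[where N=Y]) (unfold split_beta', measurable)
  then have "(\<integral>\<^sup>+G. \<integral>\<^sup>+y. of_bool (\<exists>m'\<in>I - {m}. s (G m) y \<le> s (G m') y) \<partial>K (G m) \<partial>PiM I (\<lambda>_. Q))
      = (\<integral>\<^sup>+x. \<integral>\<^sup>+G. \<integral>\<^sup>+y. of_bool (\<exists>m'\<in>I - {m}. s x y \<le> s (G m') y) \<partial>K x \<partial>PiM (I - {m}) (\<lambda>_. Q) \<partial>Q)"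
    by (subst nn_integral_PiM_split_component[OF prob_Q fin_mem]) (simp_all cong: bex_cong_simp)
  also have "\<dots> \<le> (\<integral>\<^sup>+x. \<integral>\<^sup>+y. min 1 (of_nat (card (I - {m})) * (\<integral>\<^sup>+x'. of_bool (s x y \<le> s x' y) \<partial>Q))
      \<partial>K x \<partial>Q)"
  proof (rule nn_integral_mono)
    fix x assume x_space[measurable]: "x \<in> space Q"
    interpret Kx: subprob_space "K x"
      using measurable_space[OF kernel x_space] by (simp add: space_subprob_algebra)
    have sets_eq: "sets (Q \<Otimes>\<^sub>M K x) = sets (Q \<Otimes>\<^sub>M Y)"
      by (intro sets_pair_measure_cong refl sets_kernel[OF kernel x_space])
    have "Measurable.pred (Q \<Otimes>\<^sub>M Y) (\<lambda>(x', y). s x y \<le> s x' y)" by measurable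
    then show "(\<integral>\<^sup>+G. \<integral>\<^sup>+y. of_bool (\<exists>m'\<in>I - {m}. s x y \<le> s (G m') y) \<partial>K x \<partial>PiM (I - {m}) (\<lambda>_. Q))
        \<le> (\<integral>\<^sup>+y. min 1 (of_nat (card (I - {m})) * (\<integral>\<^sup>+x'. of_bool (s x y \<le> s x' y) \<partial>Q)) \<partial>K x)"
      using fin_mem(1) by (intro nn_integral_PiM_ex_le_Fubini prob_Q Kx.sigma_finite_measure_axioms)
        (simp_all add: measurable_cong_sets[OF sets_eq refl])
  qed
  also have "\<dots> \<le> (\<integral>\<^sup>+x. \<integral>\<^sup>+y. min 1 (of_nat (card I) * (\<integral>\<^sup>+x'. of_bool (s x y \<le> s x' y) \<partial>Q)) \<partial>K x \<partial>Q)"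
    using card_Diff1_le[of I m] by (intro nn_integral_mono min.mono mult_right_mono) auto
  finally show ?thesis .
qed

lemma emeasure_max_score_error:
  assumes sets_N: "sets N = sets Y" and region: "max_score_region s (space Y) I G m \<in> sets Y"
  shows "emeasure N (space Y - max_score_region s (space Y) I G m)
    = (\<integral>\<^sup>+y. of_bool (\<exists>m'\<in>I - {m}. s (G m) y \<le> s (G m') y) \<partial>N)"
proof -
  have "emeasure N (space Y - max_score_region s (space Y) I G m)
      = (\<integral>\<^sup>+y. indicator (space Y - max_score_region s (space Y) I G m) y \<partial>N)"
    using region by (intro nn_integral_indicator[symmetric]) (auto simp: sets_N)
  also have "\<dots> = (\<integral>\<^sup>+y. of_bool (\<exists>m'\<in>I - {m}. s (G m) y \<le> s (G m') y) \<partial>N)"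
    using sets_eq_imp_space_eq[OF sets_N]
    by (intro nn_integral_cong) (auto simp: max_score_region_def indicator_def not_less)
  finally show ?thesis .
qed

lemma random_coding_union_bound:
  fixes K :: "'x \<Rightarrow> 'y measure" and s :: "'x \<Rightarrow> 'y \<Rightarrow> real" and eps :: real
  assumes prob_Q: "prob_space Q" and kernel[measurable]: "K \<in> Q \<rightarrow>\<^sub>M subprob_algebra Y"
    and s_measurable[measurable]: "case_prod s \<in> borel_measurable (Q \<Otimes>\<^sub>M Y)"
    and fin: "finite I" and "eps \<ge> 0"
    and bound: "(\<integral>\<^sup>+x. \<integral>\<^sup>+y. min 1 (of_nat (card I) * (\<integral>\<^sup>+x'. of_bool (s x y \<le> s x' y) \<partial>Q)) \<partial>K x \<partial>Q)
        \<le> ennreal eps"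
  obtains G where "\<And>m. m \<in> I \<Longrightarrow> G m \<in> space Q"
    "\<And>m. m \<in> I \<Longrightarrow> max_score_region s (space Y) I G m \<in> sets Y"
    "(\<Sum>m\<in>I. emeasure (K (G m)) (space Y - max_score_region s (space Y) I G m)) \<le> ennreal (card I * eps)"
proof -
  interpret C: prob_space "PiM I (\<lambda>_. Q)" by (intro prob_space_PiM prob_Q)
  define err where "err G m = (\<integral>\<^sup>+y. of_bool (\<exists>m'\<in>I - {m}. s (G m) y \<le> s (G m') y) \<partial>K (G m))" for G m
  have [measurable]: "(\<lambda>G. G k) \<in> PiM I (\<lambda>_. Q) \<rightarrow>\<^sub>M Q" if "k \<in> I" for k
    using that by (rule measurable_component_singleton)
  have [measurable]: "(\<lambda>G. err G m) \<in> borel_measurable (PiM I (\<lambda>_. Q))" if "m \<in> I" for m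
    unfolding err_def using fin that
    by (intro nn_integral_measurable_subprob_algebra2[where N=Y]) (unfold split_beta', measurable)
  have "(\<integral>\<^sup>+G. (\<Sum>m\<in>I. err G m) \<partial>PiM I (\<lambda>_. Q)) = (\<Sum>m\<in>I. \<integral>\<^sup>+G. err G m \<partial>PiM I (\<lambda>_. Q))"
    by (rule nn_integral_sum) measurable
  also have "\<dots> \<le> (\<Sum>m\<in>I. ennreal eps)"
    unfolding err_def
    by (intro sum_mono order_trans[OF nn_integral_random_code_error_le[where Y=Y] bound]
        prob_Q kernel s_measurable fin)
  also have "\<dots> = ennreal (card I * eps)"
    using \<open>eps \<ge> 0\<close> by (simp add: ennreal_mult' ennreal_of_nat_eq_real_of_nat)
  finally obtain G where G_props: "G \<in> space (PiM I (\<lambda>_. Q))" "(\<Sum>m\<in>I. err G m) \<le> ennreal (card I * eps)"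
    by (rule C.nn_integral_le_obtains[rotated]) measurable
  have G_space: "G m \<in> space Q" if "m \<in> I" for m
    using G_props(1) that by (auto simp: space_PiM)
  have [measurable]: "s (G m) \<in> borel_measurable Y" if "m \<in> I" for m
    using measurable_compose[OF measurable_Pair1'[OF G_space[OF that]] s_measurable] by simp
  have region: "max_score_region s (space Y) I G m \<in> sets Y" if "m \<in> I" for m
    unfolding max_score_region_def by (insert fin that) measurable
  have "emeasure (K (G m)) (space Y - max_score_region s (space Y) I G m) = err G m" if "m \<in> I" for m
    unfolding err_def using that
    by (intro emeasure_max_score_error sets_kernel[OF kernel] G_space region)
  with G_props(2) have "(\<Sum>m\<in>I. emeasure (K (G m)) (space Y - max_score_region s (space Y) I G m))
      \<le> ennreal (card I * eps)"
    by simp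
  with G_space region show thesis by (rule that)
qed

section \<open>The Gaussian channel\<close>

lemma sets_out_space[measurable_cong]: "sets (out_space n) = sets (PiM {..<n} (\<lambda>_. borel))"
  unfolding out_space_def by (intro sets_PiM_cong) auto

lemma W_awgn_eq_normal_density: "W_awgn y x = normal_density x 1 y"
  by (simp add: W_awgn_def normal_density_def)

lemma Wn_eq_distr_gauss: "Wn n x = distr (gauss n) (out_space n) (\<lambda>z. \<lambda>i\<in>{..<n}. x i + z i)"
proof -
  have "normal_distribution (x i) 1 = distr std_normal_distribution lborel (\<lambda>z. x i + z)" for i
    using normal_distribution_eq_distr[of 1 "x i"] by simp
  then show ?thesis
    unfolding Wn_def gauss_def out_space_def W_awgn_eq_normal_density
    by (simp only:) (rule PiM_distr[OF finite_lessThan prob_space_std_normal], measurable)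
qed

lemma prob_space_Wn: "prob_space (Wn n x)"
  unfolding Wn_eq_distr_gauss by (rule prob_space.prob_space_distr[OF prob_space_gauss]) measurable

lemma sets_Wn: "sets (Wn n x) = sets (out_space n)"
  by (simp add: Wn_eq_distr_gauss)

lemma nn_integral_Wn:
  assumes [measurable]: "f \<in> borel_measurable (out_space n)"
  shows "(\<integral>\<^sup>+y. f y \<partial>Wn n x) = (\<integral>\<^sup>+z. f (\<lambda>i\<in>{..<n}. x i + z i) \<partial>gauss n)"
  unfolding Wn_eq_distr_gauss by (rule nn_integral_distr) measurable

lemma measurable_Wn:
  assumes [measurable]: "\<And>i. (\<lambda>g. X g i) \<in> borel_measurable Q"
  shows "(\<lambda>g. Wn n (X g)) \<in> Q \<rightarrow>\<^sub>M subprob_algebra (out_space n)"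
  unfolding Wn_eq_distr_gauss
proof (rule measurable_distr2)
  show "(\<lambda>(g, z). \<lambda>i\<in>{..<n}. X g i + z i) \<in> Q \<Otimes>\<^sub>M gauss n \<rightarrow>\<^sub>M out_space n"
    unfolding split_beta' by measurable
  show "(\<lambda>_. gauss n) \<in> Q \<rightarrow>\<^sub>M subprob_algebra (gauss n)"
    using prob_space_imp_subprob_space[OF prob_space_gauss] by (simp add: space_subprob_algebra)
qed

lemma random_code_exists:
  fixes X :: "'g \<Rightarrow> nat \<Rightarrow> real" and s :: "'g \<Rightarrow> (nat \<Rightarrow> real) \<Rightarrow> real"
  assumes prob_Q: "prob_space Q" and X_measurable: "\<And>i. (\<lambda>g. X g i) \<in> borel_measurable Q"
    and power: "\<And>g. g \<in> space Q \<Longrightarrow> (\<Sum>i<n. (X g i)\<^sup>2) \<le> real n * P"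
    and s_measurable: "case_prod s \<in> borel_measurable (Q \<Otimes>\<^sub>M out_space n)"
    and M_pos: "M \<ge> 1" and eps_nonneg: "eps \<ge> 0"
    and bound: "(\<integral>\<^sup>+g. \<integral>\<^sup>+y. min 1 (of_nat M * (\<integral>\<^sup>+g'. of_bool (s g y \<le> s g' y) \<partial>Q)) \<partial>Wn n (X g) \<partial>Q)
        \<le> ennreal eps"
  shows "\<exists>x D. is_av_code n M eps P x D"
proof -
  obtain G where G_space: "\<And>m. m \<in> {1..M} \<Longrightarrow> G m \<in> space Q"
    and region_sets: "\<And>m. m \<in> {1..M} \<Longrightarrow> max_score_region s (space (out_space n)) {1..M} G m
        \<in> sets (out_space n)"
    and total_error: "(\<Sum>m=1..M. emeasure (Wn n (X (G m)))
        (space (out_space n) - max_score_region s (space (out_space n)) {1..M} G m))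
        \<le> ennreal (card {1..M} * eps)"
    by (rule random_coding_union_bound[OF prob_Q measurable_Wn[where X=X, OF X_measurable] s_measurable
          finite_atLeastAtMost[of 1 M] eps_nonneg]) (use bound in auto)
  define D where "D = max_score_region s (space (out_space n)) {1..M} G"
  have "(\<Sum>m=1..M. emeasure (Wn n (X (G m))) (space (out_space n) - D m))
      = ennreal (\<Sum>m=1..M. measure (Wn n (X (G m))) (space (out_space n) - D m))"
    by (simp add: finite_measure.emeasure_eq_measure[OF prob_space.finite_measure[OF prob_space_Wn]]
        sum_ennreal)
  with total_error have "(\<Sum>m=1..M. measure (Wn n (X (G m))) (space (out_space n) - D m)) \<le> real M * eps"
    using eps_nonneg by (simp add: D_def)
  then have "1 / real M * (\<Sum>m=1..M. measure (Wn n (X (G m))) (space (out_space n) - D m)) \<le> eps"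
    using M_pos by (simp add: divide_le_eq mult.commute)
  moreover have "D m \<inter> D m' = {}" if "m \<in> {1..M}" "m' \<in> {1..M}" "m \<noteq> m'" for m m'
    unfolding D_def using that by (rule max_score_region_disjoint)
  ultimately have "is_av_code n M eps P (\<lambda>m. X (G m)) D"
    unfolding is_av_code_def using region_sets[folded D_def] power[OF G_space] by blast
  then show ?thesis by blast
qed

section \<open>Spherical codes\<close>

definition unit_vec :: "nat \<Rightarrow> (nat \<Rightarrow> real) \<Rightarrow> nat \<Rightarrow> real" where
  "unit_vec n g i =
    (if i < n then if (\<Sum>k<n. (g k)\<^sup>2) = 0 then of_bool (i = 0) else g i / sqrt (\<Sum>k<n. (g k)\<^sup>2) else 0)"

lemma measurable_unit_vec[measurable]: "(\<lambda>g. unit_vec n g i) \<in> borel_measurable (PiM {..<n} (\<lambda>_. borel))"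
proof (cases "i < n")
  case True
  have "{g \<in> space (PiM {..<n} (\<lambda>_. borel)). (\<Sum>k<n. (g k)\<^sup>2) = (0::real)} \<in> sets (PiM {..<n} (\<lambda>_. borel))"
    by (rule borel_measurable_eq) measurable
  with True show ?thesis unfolding unit_vec_def by (auto intro!: measurable_If)
qed (simp add: unit_vec_def)

lemma norm_unit_vec:
  assumes "n > 0" shows "(\<Sum>i<n. (unit_vec n g i)\<^sup>2) = 1"
proof (cases "(\<Sum>k<n. (g k)\<^sup>2) = 0")
  case True
  then have "(\<Sum>i<n. (unit_vec n g i)\<^sup>2) = (\<Sum>i<n. if i = 0 then 1 else 0)"
    by (intro sum.cong) (auto simp: unit_vec_def)
  then show ?thesis using assms by simp
next
  case False
  then have "(\<Sum>i<n. (unit_vec n g i)\<^sup>2) = (\<Sum>i<n. (g i)\<^sup>2 / (\<Sum>k<n. (g k)\<^sup>2))"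
    by (intro sum.cong) (auto simp: unit_vec_def power_divide sum_nonneg)
  then show ?thesis using False by (simp add: sum_divide_distrib[symmetric])
qed

text \<open>The probability that a uniform unit vector in dimension \<open>n + 1\<close> has inner product at least
  \<open>t\<close> with a fixed vector of squared norm \<open>q\<close>.\<close>

definition cap_prob :: "nat \<Rightarrow> real \<Rightarrow> real \<Rightarrow> ennreal" where
  "cap_prob n t q = (\<integral>\<^sup>+a. \<integral>\<^sup>+r. of_bool (t \<le> sqrt q * a / sqrt (a\<^sup>2 + r\<^sup>2)) \<partial>chi n
      \<partial>std_normal_distribution)"

lemma measurable_cap_prob[measurable]:
  assumes [measurable]: "t \<in> borel_measurable N" "q \<in> borel_measurable N"
  shows "(\<lambda>x. cap_prob n (t x) (q x)) \<in> borel_measurable N"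
proof -
  interpret pair_sigma_finite "chi n" std_normal_distribution by (rule pair_sigma_finite_chi_std_normal)
  show ?thesis unfolding cap_prob_def by measurable
qed

lemma nn_integral_unit_vec_score:
  "(\<integral>\<^sup>+g. of_bool (t \<le> (\<Sum>k<Suc n. unit_vec (Suc n) g k * y k)) \<partial>gauss (Suc n))
      = cap_prob n t (\<Sum>k<Suc n. (y k)\<^sup>2)"
proof -
  have "(\<integral>\<^sup>+g. of_bool (t \<le> (\<Sum>k<Suc n. unit_vec (Suc n) g k * y k)) \<partial>gauss (Suc n))
      = (\<integral>\<^sup>+g. of_bool (t \<le> (\<Sum>k<Suc n. y k * g k) / sqrt (\<Sum>k<Suc n. (g k)\<^sup>2)) \<partial>gauss (Suc n))"
  proof (rule nn_integral_cong_AE)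
    show "AE g in gauss (Suc n). of_bool (t \<le> (\<Sum>k<Suc n. unit_vec (Suc n) g k * y k))
        = (of_bool (t \<le> (\<Sum>k<Suc n. y k * g k) / sqrt (\<Sum>k<Suc n. (g k)\<^sup>2)) :: ennreal)"
      using AE_gauss_norm_pos[of "Suc n", simplified]
    proof eventually_elim
      case (elim g)
      then have "(\<Sum>k<Suc n. unit_vec (Suc n) g k * y k) = (\<Sum>k<Suc n. y k * g k / sqrt (\<Sum>k<Suc n. (g k)\<^sup>2))"
        by (intro sum.cong) (auto simp: unit_vec_def)
      then show ?case by (simp add: sum_divide_distrib[symmetric] del: sum.lessThan_Suc)
    qed
  qed
  also have "\<dots> = cap_prob n t (\<Sum>k<Suc n. (y k)\<^sup>2)"
    unfolding cap_prob_def
    by (rule nn_integral_gauss_inner_norm[where f="\<lambda>x q. of_bool (t \<le> x / sqrt q)"]) measurable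
  finally show ?thesis .
qed

lemma cap_imp_cone:
  fixes t y a r :: real
  assumes "t > 0" "y > 0" "r > 0" and cap: "t \<le> sqrt (t\<^sup>2 + y\<^sup>2) * a / sqrt (a\<^sup>2 + r\<^sup>2)"
  shows "t / y * r \<le> a"
proof -
  have norm_pos: "sqrt (a\<^sup>2 + r\<^sup>2) > 0" using assms by (simp add: add_nonneg_pos)
  have score_le: "t * sqrt (a\<^sup>2 + r\<^sup>2) \<le> sqrt (t\<^sup>2 + y\<^sup>2) * a"
    using cap norm_pos by (simp add: pos_le_divide_eq)
  moreover have "0 < t * sqrt (a\<^sup>2 + r\<^sup>2)" using assms norm_pos by simp
  ultimately have "0 < sqrt (t\<^sup>2 + y\<^sup>2) * a" by linarith
  then have a_pos: "a > 0" by (auto simp: zero_less_mult_iff not_sum_power2_lt_zero)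
  have "(t * sqrt (a\<^sup>2 + r\<^sup>2))\<^sup>2 \<le> (sqrt (t\<^sup>2 + y\<^sup>2) * a)\<^sup>2"
    using score_le assms norm_pos by (intro power_mono) auto
  then have "(t * r)\<^sup>2 \<le> (y * a)\<^sup>2" by (simp add: power_mult_distrib algebra_simps)
  then have "t * r \<le> y * a" by (rule power2_le_imp_le) (use a_pos assms in simp)
  then show ?thesis using assms by (simp add: field_simps)
qed

lemma cap_prob_le_cone_prob:
  assumes "n > 0" "t > 0" "y > 0"
  shows "cap_prob n t (t\<^sup>2 + y\<^sup>2) \<le> cone_prob n (t / y)"
  unfolding cap_prob_def cone_prob_def
proof (rule nn_integral_mono, rule nn_integral_mono_AE)
  fix a
  show "AE r in chi n. of_bool (t \<le> sqrt (t\<^sup>2 + y\<^sup>2) * a / sqrt (a\<^sup>2 + r\<^sup>2))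
      \<le> (of_bool (t / y * r \<le> a) :: ennreal)"
    using AE_chi_pos[OF assms(1)]
  proof eventually_elim
    case (elim r)
    then show ?case using cap_imp_cone[OF assms(2,3) elim, of a] by (auto simp: of_bool_def)
  qed
qed

lemma nn_integral_Wn_inner_norm:
  fixes f :: "real \<Rightarrow> real \<Rightarrow> ennreal"
  assumes [measurable]: "case_prod f \<in> borel_measurable (borel \<Otimes>\<^sub>M borel)"
    and unit: "(\<Sum>k<Suc n. (e k)\<^sup>2) = 1"
  shows "(\<integral>\<^sup>+y. f (\<Sum>k<Suc n. e k * y k) (\<Sum>k<Suc n. (y k)\<^sup>2) \<partial>Wn (Suc n) (\<lambda>k. A * e k))
    = (\<integral>\<^sup>+x. \<integral>\<^sup>+r. f (A + x) ((A + x)\<^sup>2 + r\<^sup>2) \<partial>chi n \<partial>std_normal_distribution)"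
proof -
  have inner: "(\<Sum>k<Suc n. e k * (A * e k + z k)) = A + (\<Sum>k<Suc n. e k * z k)" for z
  proof -
    have "(\<Sum>k<Suc n. e k * (A * e k + z k)) = A * (\<Sum>k<Suc n. (e k)\<^sup>2) + (\<Sum>k<Suc n. e k * z k)"
      unfolding sum_distrib_left sum.distrib[symmetric]
      by (intro sum.cong) (auto simp: power2_eq_square algebra_simps)
    then show ?thesis unfolding unit by simp
  qed
  have norm_square: "(\<Sum>k<Suc n. (A * e k + z k)\<^sup>2)
      = A\<^sup>2 + 2 * A * (\<Sum>k<Suc n. e k * z k) + (\<Sum>k<Suc n. (z k)\<^sup>2)" for z
  proof -
    have "(\<Sum>k<Suc n. (A * e k + z k)\<^sup>2)
        = A\<^sup>2 * (\<Sum>k<Suc n. (e k)\<^sup>2) + 2 * A * (\<Sum>k<Suc n. e k * z k) + (\<Sum>k<Suc n. (z k)\<^sup>2)"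
      unfolding sum_distrib_left sum.distrib[symmetric]
      by (intro sum.cong) (auto simp: power2_eq_square algebra_simps)
    then show ?thesis unfolding unit by simp
  qed
  have "(\<integral>\<^sup>+y. f (\<Sum>k<Suc n. e k * y k) (\<Sum>k<Suc n. (y k)\<^sup>2) \<partial>Wn (Suc n) (\<lambda>k. A * e k))
      = (\<integral>\<^sup>+z. f (\<Sum>k<Suc n. e k * (A * e k + z k)) (\<Sum>k<Suc n. (A * e k + z k)\<^sup>2) \<partial>gauss (Suc n))"
    by (subst nn_integral_Wn) (auto simp del: sum.lessThan_Suc cong: sum.cong_simp)
  also have "\<dots> = (\<integral>\<^sup>+x. \<integral>\<^sup>+r. f (A + sqrt (\<Sum>k<Suc n. (e k)\<^sup>2) * x)
      (A\<^sup>2 + 2 * A * (sqrt (\<Sum>k<Suc n. (e k)\<^sup>2) * x) + (x\<^sup>2 + r\<^sup>2)) \<partial>chi n \<partial>std_normal_distribution)"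
    unfolding inner norm_square
    by (rule nn_integral_gauss_inner_norm[where f="\<lambda>x q. f (A + x) (A\<^sup>2 + 2 * A * x + q)"]) measurable
  also have "\<dots> = (\<integral>\<^sup>+x. \<integral>\<^sup>+r. f (A + x) ((A + x)\<^sup>2 + r\<^sup>2) \<partial>chi n \<partial>std_normal_distribution)"
    unfolding unit by (simp add: power2_sum ac_simps)
  finally show ?thesis .
qed

lemma min_one_mult_cap_prob_le:
  assumes "n > 0" "w > 0" "y > 0"
  shows "min 1 (c * cap_prob n t (t\<^sup>2 + y\<^sup>2))
      \<le> of_bool (t \<le> w * y) + c * (of_bool (w * y < t) * cone_prob n (t / y))"
proof (cases "w * y < t")
  case True
  then have "0 < t" using mult_pos_pos[OF assms(2,3)] by linarith
  then have "cap_prob n t (t\<^sup>2 + y\<^sup>2) \<le> cone_prob n (t / y)"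
    using assms by (intro cap_prob_le_cone_prob)
  then have "c * cap_prob n t (t\<^sup>2 + y\<^sup>2) \<le> c * cone_prob n (t / y)" by (intro mult_left_mono) auto
  then show ?thesis using True by (simp add: min.coboundedI2)
qed simp

lemma own_score_prob_le:
  assumes n_ge_4: "n \<ge> 4" and w_pos: "w > 0" and P_nonneg: "P \<ge> 0"
  shows "(\<integral>\<^sup>+x. \<integral>\<^sup>+y. of_bool (sqrt (real (Suc n) * P) + x \<le> w * y) \<partial>chi n \<partial>std_normal_distribution)
    \<le> ennreal (Phi (sqrt (Suc n) * (w - sqrt P) / sqrt (1 + w\<^sup>2 / 2)) + 16 / sqrt (Suc n))"
proof -
  obtain j where n_Suc: "n = Suc j" using n_ge_4 by (metis Suc_le_D numeral_eq_Suc)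
  have "sqrt (9 * real (Suc n)) \<le> sqrt (16 * real j)" using n_ge_4 n_Suc by (intro real_sqrt_le_mono) simp
  then have sqrt_le: "3 * sqrt (Suc n) \<le> 4 * sqrt j" unfolding real_sqrt_mult by simp
  have "(\<integral>\<^sup>+x. \<integral>\<^sup>+y. of_bool (sqrt (real (Suc n) * P) + x \<le> w * y) \<partial>chi n \<partial>std_normal_distribution)
      \<le> ennreal (Phi ((w * sqrt j - sqrt (real (Suc n) * P)) / sqrt (1 + w\<^sup>2 / 2)) + 12 / sqrt j)"
    unfolding n_Suc using n_ge_4 n_Suc by (intro nn_integral_std_normal_chi_le_Phi) simp
  also have "\<dots> \<le> ennreal (Phi (sqrt (Suc n) * (w - sqrt P) / sqrt (1 + w\<^sup>2 / 2)) + 16 / sqrt (Suc n))"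
  proof (intro ennreal_leI add_mono Phi_mono divide_right_mono)
    have "w * sqrt j \<le> w * sqrt (Suc n)" using w_pos n_Suc by (intro mult_left_mono) auto
    then show "w * sqrt j - sqrt (real (Suc n) * P) \<le> sqrt (Suc n) * (w - sqrt P)"
      unfolding real_sqrt_mult right_diff_distrib by (simp add: mult.commute del: of_nat_Suc)
    show "12 / sqrt j \<le> 16 / sqrt (Suc n)" using sqrt_le n_ge_4 n_Suc by (simp add: divide_simps)
  qed simp
  finally show ?thesis .
qed

lemma nn_integral_Wn_rcu_le:
  assumes n_ge_4: "n \<ge> 4" and w_pos: "w > 0" and P_nonneg: "P \<ge> 0" and unit: "(\<Sum>k<Suc n. (e k)\<^sup>2) = 1"
  shows "(\<integral>\<^sup>+y. min 1 (of_nat M * cap_prob n (\<Sum>k<Suc n. e k * y k) (\<Sum>k<Suc n. (y k)\<^sup>2))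
      \<partial>Wn (Suc n) (\<lambda>k. sqrt (real (Suc n) * P) * e k))
    \<le> ennreal (Phi (sqrt (Suc n) * (w - sqrt P) / sqrt (1 + w\<^sup>2 / 2)) + 16 / sqrt (Suc n)
      + real M * (3 * (1 + w\<^sup>2)\<^sup>2 / (w\<^sup>2 * real (Suc n) * sqrt (1 + w\<^sup>2) ^ Suc n)))"
    (is "?L \<le> ennreal (?p + real M * ?p')")
proof -
  define A where "A = sqrt (real (Suc n) * P)"
  have n_pos: "n > 0" using n_ge_4 by simp
  interpret chi: prob_space "chi n" by (rule prob_space_chi)
  have "?L = (\<integral>\<^sup>+x. \<integral>\<^sup>+y. min 1 (of_nat M * cap_prob n (A + x) ((A + x)\<^sup>2 + y\<^sup>2)) \<partial>chi n
      \<partial>std_normal_distribution)"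
    unfolding A_def
    by (rule nn_integral_Wn_inner_norm[where f="\<lambda>t q. min 1 (of_nat M * cap_prob n t q)"])
      (measurable, rule unit)
  also have "\<dots> \<le> (\<integral>\<^sup>+x. \<integral>\<^sup>+y. of_bool (A + x \<le> w * y)
      + of_nat M * (of_bool (w * y < A + x) * cone_prob n ((A + x) / y)) \<partial>chi n \<partial>std_normal_distribution)"
  proof (rule nn_integral_mono, rule nn_integral_mono_AE)
    fix x
    show "AE y in chi n. min 1 (of_nat M * cap_prob n (A + x) ((A + x)\<^sup>2 + y\<^sup>2))
        \<le> of_bool (A + x \<le> w * y) + of_nat M * (of_bool (w * y < A + x) * cone_prob n ((A + x) / y))"
      using AE_chi_pos[OF n_pos]
    proof eventually_elim
      case (elim y)
      show ?case using n_pos w_pos elim by (rule min_one_mult_cap_prob_le)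
    qed
  qed
  also have "\<dots> = (\<integral>\<^sup>+x. \<integral>\<^sup>+y. of_bool (A + x \<le> w * y) \<partial>chi n \<partial>std_normal_distribution)
      + of_nat M * (\<integral>\<^sup>+x. \<integral>\<^sup>+y. of_bool (w * y < A + x) * cone_prob n
        ((A + x) / y) \<partial>chi n \<partial>std_normal_distribution)"
    by (subst nn_integral_add, measurable, subst nn_integral_cmult, measurable,
        subst nn_integral_add, measurable, subst nn_integral_cmult, measurable)
  also have "\<dots> \<le> ennreal ?p + of_nat M * ennreal ?p'"
    unfolding A_def by (intro add_mono mult_left_mono own_score_prob_le competitor_prob_le
        n_ge_4 w_pos P_nonneg) simp
  also have "\<dots> = ennreal (?p + real M * ?p')"
  proof -
    have "0 \<le> ?p" "0 \<le> ?p'" by (simp_all add: Phi_nonneg)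
    then show ?thesis
      by (simp only: ennreal_plus ennreal_mult' ennreal_of_nat_eq_real_of_nat
          mult_nonneg_nonneg of_nat_0_le_iff)
  qed
  finally show ?thesis .
qed

lemma spherical_code_exists:
  fixes P w eps :: real
  assumes n_ge_4: "n \<ge> 4" and w_pos: "w > 0" and P_nonneg: "P \<ge> 0" and M_pos: "M \<ge> 1"
    and bound: "Phi (sqrt (Suc n) * (w - sqrt P) / sqrt (1 + w\<^sup>2 / 2)) + 16 / sqrt (Suc n)
      + real M * (3 * (1 + w\<^sup>2)\<^sup>2 / (w\<^sup>2 * real (Suc n) * sqrt (1 + w\<^sup>2) ^ Suc n)) \<le> eps"
  shows "\<exists>x D. is_av_code (Suc n) M eps P x D"
proof -
  define X where "X g k = sqrt (real (Suc n) * P) * unit_vec (Suc n) g k" for g k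
  define s where "s g y = (\<Sum>k<Suc n. unit_vec (Suc n) g k * y k)" for g y :: "nat \<Rightarrow> real"
  interpret G: prob_space "gauss (Suc n)" by (rule prob_space_gauss)
  show ?thesis
  proof (rule random_code_exists[where Q="gauss (Suc n)" and X=X and s=s])
    show "(\<Sum>k<Suc n. (X g k)\<^sup>2) \<le> real (Suc n) * P" for g
    proof -
      have "(\<Sum>k<Suc n. (X g k)\<^sup>2) = real (Suc n) * P * (\<Sum>k<Suc n. (unit_vec (Suc n) g k)\<^sup>2)"
        unfolding X_def power_mult_distrib sum_distrib_left using P_nonneg by (simp del: of_nat_Suc)
      then show ?thesis unfolding norm_unit_vec[OF zero_less_Suc] by simp
    qed
    show "(\<lambda>g. X g k) \<in> borel_measurable (gauss (Suc n))" for k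
      unfolding X_def by measurable
    show "case_prod s \<in> borel_measurable (gauss (Suc n) \<Otimes>\<^sub>M out_space (Suc n))"
      unfolding s_def split_beta' by measurable
    show "0 \<le> eps" by (rule order_trans[OF _ bound]) (simp add: Phi_nonneg)
    have "(\<integral>\<^sup>+y. min 1 (of_nat M * (\<integral>\<^sup>+g'. of_bool (s g y \<le> s g' y) \<partial>gauss (Suc n))) \<partial>Wn (Suc n) (X g))
        \<le> ennreal eps" for g
      unfolding s_def X_def nn_integral_unit_vec_score
      by (rule order_trans[OF nn_integral_Wn_rcu_le[OF n_ge_4 w_pos P_nonneg norm_unit_vec]
            ennreal_leI[OF bound]]) simp
    then have "(\<integral>\<^sup>+g. \<integral>\<^sup>+y. min 1 (of_nat M * (\<integral>\<^sup>+g'. of_bool (s g y \<le> s g' y) \<partial>gauss (Suc n)))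
        \<partial>Wn (Suc n) (X g) \<partial>gauss (Suc n)) \<le> (\<integral>\<^sup>+g. ennreal eps \<partial>gauss (Suc n))"
      by (rule nn_integral_mono)
    then show "(\<integral>\<^sup>+g. \<integral>\<^sup>+y. min 1 (of_nat M * (\<integral>\<^sup>+g'. of_bool (s g y \<le> s g' y) \<partial>gauss (Suc n)))
        \<partial>Wn (Suc n) (X g) \<partial>gauss (Suc n)) \<le> ennreal eps"
      by (simp add: G.emeasure_space_1)
  qed (rule G.prob_space_axioms M_pos)+
qed

section \<open>Finiteness of the maximal code size\<close>

lemma PiM_normal_distribution:
  assumes "\<sigma> > 0"
  shows "PiM {..<n} (\<lambda>i. normal_distribution (x i) \<sigma>)
    = density (out_space n) (\<lambda>y. \<Prod>i<n. ennreal (normal_density (x i) \<sigma> (y i)))"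
  unfolding out_space_def using assms
  by (intro PiM_density)
    (auto intro: lborel.sigma_finite_measure_axioms prob_space_imp_sigma_finite prob_space_normal_density)

lemma normal_density_le_wider:
  "normal_density x 1 y \<le> exp (x\<^sup>2 / 2) * sqrt 2 * normal_density 0 (sqrt 2) y"
proof -
  have "0 \<le> (y / 2 - x)\<^sup>2" by simp
  moreover have "x\<^sup>2 / 2 + - y\<^sup>2 / 4 - - ((y - x)\<^sup>2) / 2 = (y / 2 - x)\<^sup>2"
    by (simp add: power2_eq_square field_simps)
  ultimately have "- ((y - x)\<^sup>2) / 2 \<le> x\<^sup>2 / 2 + - y\<^sup>2 / 4" by linarith
  then have "exp (- ((y - x)\<^sup>2) / 2) \<le> exp (x\<^sup>2 / 2 + - y\<^sup>2 / 4)" unfolding exp_le_cancel_iff .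
  then have "1 / sqrt (2 * pi) * exp (- ((y - x)\<^sup>2) / 2)
      \<le> 1 / sqrt (2 * pi) * (exp (x\<^sup>2 / 2) * exp (- y\<^sup>2 / 4))"
    unfolding exp_add by (intro mult_left_mono) auto
  also have "\<dots> = exp (x\<^sup>2 / 2) * sqrt 2 * normal_density 0 (sqrt 2) y"
    by (simp add: normal_density_def real_sqrt_mult) (simp add: field_simps)
  finally show ?thesis by (simp add: normal_density_def)
qed

lemma emeasure_Wn_le_wider_normal:
  assumes D_sets: "D \<in> sets (out_space n)"
  shows "emeasure (Wn n x) D
    \<le> ennreal (exp ((\<Sum>i<n. (x i)\<^sup>2) / 2) * sqrt 2 ^ n) * emeasure (PiM {..<n}
      (\<lambda>_. normal_distribution 0 (sqrt 2))) D"
proof -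
  let ?C = "exp ((\<Sum>i<n. (x i)\<^sup>2) / 2) * sqrt 2 ^ n"
  have [measurable]: "D \<in> sets (PiM {..<n} (\<lambda>_. borel))" using D_sets by (simp add: sets_out_space)
  have "(\<Prod>i<n. ennreal (normal_density (x i) 1 (y i)))
      \<le> ennreal ?C * (\<Prod>i<n. ennreal (normal_density 0 (sqrt 2) (y i)))" for y
  proof -
    have "(\<Prod>i<n. normal_density (x i) 1 (y i))
        \<le> (\<Prod>i<n. exp ((x i)\<^sup>2 / 2) * sqrt 2 * normal_density 0 (sqrt 2) (y i))"
      by (intro prod_mono conjI normal_density_le_wider) simp
    also have "\<dots> = ?C * (\<Prod>i<n. normal_density 0 (sqrt 2) (y i))"
      by (simp add: prod.distrib exp_sum[symmetric] sum_divide_distrib)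
    finally show ?thesis by (simp add: prod_ennreal prod_nonneg ennreal_mult'[symmetric] ennreal_leI)
  qed
  then have "(\<integral>\<^sup>+y. (\<Prod>i<n. ennreal (normal_density (x i) 1 (y i))) * indicator D y \<partial>out_space n)
      \<le> (\<integral>\<^sup>+y. ennreal ?C * ((\<Prod>i<n. ennreal (normal_density 0 (sqrt 2)
        (y i))) * indicator D y) \<partial>out_space n)"
    by (intro nn_integral_mono) (simp add: mult.assoc[symmetric] mult_right_mono)
  also have "\<dots> = ennreal ?C * (\<integral>\<^sup>+y. (\<Prod>i<n. ennreal (normal_density 0 (sqrt 2) (y i)))
      * indicator D y \<partial>out_space n)"
    by (rule nn_integral_cmult) measurable
  finally show ?thesis
    using D_sets by (simp add: Wn_def W_awgn_eq_normal_density PiM_normal_distribution emeasure_density)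
qed

lemma code_size_le_of_dominated:
  assumes code: "is_av_code n M eps P x D"
    and prob_V: "prob_space V" and sets_V: "sets V = sets (out_space n)"
    and dominated: "\<And>m. m \<in> {1..M} \<Longrightarrow> measure (Wn n (x m)) (D m) \<le> C * measure V (D m)" and C_nonneg: "C \<ge> 0"
  shows "real M * (1 - eps) \<le> C"
proof (cases "M = 0")
  case False
  interpret V: prob_space V by fact
  have D_sets: "D m \<in> sets (out_space n)" if "m \<in> {1..M}" for m
    using code that unfolding is_av_code_def by auto
  have disjoint: "disjoint_family_on D {1..M}"
    using code unfolding is_av_code_def disjoint_family_on_def by blast
  have "measure (Wn n (x m)) (space (out_space n) - D m) = 1 - measure (Wn n (x m)) (D m)"
    if "m \<in> {1..M}" for m
    using prob_space.prob_compl[OF prob_space_Wn, of "D m" n "x m"] D_sets[OF that]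
    by (simp add: sets_Wn sets_eq_imp_space_eq[OF sets_Wn])
  then have "1 / real M * (\<Sum>m=1..M. 1 - measure (Wn n (x m)) (D m)) \<le> eps"
    using code unfolding is_av_code_def by simp
  then have "real M - (\<Sum>m=1..M. measure (Wn n (x m)) (D m)) \<le> real M * eps"
    using False by (simp add: sum_subtractf divide_le_eq mult.commute)
  moreover have "(\<Sum>m=1..M. measure (Wn n (x m)) (D m)) \<le> (\<Sum>m=1..M. C * measure V (D m))"
    by (intro sum_mono dominated)
  moreover have "\<dots> = C * measure V (\<Union>m\<in>{1..M}. D m)"
    using disjoint D_sets by (subst V.finite_measure_finite_Union) (auto simp: sum_distrib_left sets_V)
  moreover have "\<dots> \<le> C" using C_nonneg by (simp add: mult_left_le)
  ultimately show ?thesis by (simp add: right_diff_distrib)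
qed (use C_nonneg in simp)

lemma code_size_bounded:
  assumes code: "is_av_code n M eps P x D"
  shows "real M * (1 - eps) \<le> exp (real n * P / 2) * sqrt 2 ^ n"
proof (rule code_size_le_of_dominated[OF code])
  let ?V = "PiM {..<n} (\<lambda>_. normal_distribution 0 (sqrt 2))"
  show "prob_space ?V" by (intro prob_space_PiM prob_space_normal_density) simp
  then interpret V: prob_space ?V .
  show "sets ?V = sets (out_space n)" unfolding out_space_def by (intro sets_PiM_cong) auto
  show "measure (Wn n (x m)) (D m) \<le> exp (real n * P / 2) * sqrt 2 ^ n * measure ?V (D m)"
    if m_mem: "m \<in> {1..M}" for m
  proof -
    interpret W: prob_space "Wn n (x m)" by (rule prob_space_Wn)
    have D_sets: "D m \<in> sets (out_space n)" and power: "(\<Sum>i<n. (x m i)\<^sup>2) \<le> real n * P"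
      using code m_mem unfolding is_av_code_def by auto
    have "measure (Wn n (x m)) (D m) \<le> exp ((\<Sum>i<n. (x m i)\<^sup>2) / 2) * sqrt 2 ^ n * measure ?V (D m)"
      using emeasure_Wn_le_wider_normal[OF D_sets, of "x m"]
      by (simp add: W.emeasure_eq_measure V.emeasure_eq_measure ennreal_mult'[symmetric])
    also have "\<dots> \<le> exp (real n * P / 2) * sqrt 2 ^ n * measure ?V (D m)"
      using power by (intro mult_right_mono) auto
    finally show ?thesis .
  qed
qed simp

lemma code_size_le_Mstar:
  assumes "is_av_code n M eps P x D" "eps < 1"
  shows "M \<le> Mstar n eps P"
  unfolding Mstar_def
proof (rule Greatest_le_nat)
  show "\<exists>x D. is_av_code n M eps P x D" using assms by blast
  fix K assume "\<exists>x D. is_av_code n K eps P x D"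
  then have "real K * (1 - eps) \<le> exp (real n * P / 2) * sqrt 2 ^ n" using code_size_bounded by blast
  then have "real K \<le> exp (real n * P / 2) * sqrt 2 ^ n / (1 - eps)"
    using assms(2) by (simp add: pos_le_divide_eq)
  then show "K \<le> nat \<lceil>exp (real n * P / 2) * sqrt 2 ^ n / (1 - eps)\<rceil>" by linarith
qed

section \<open>Asymptotics\<close>

lemma ln_Mstar_ge:
  assumes n_ge_5: "n \<ge> 5" and w_pos: "w > 0" and P_nonneg: "P \<ge> 0" and eps_less_1: "eps < 1"
    and error: "Phi (sqrt n * (w - sqrt P) / sqrt (1 + w\<^sup>2 / 2)) + (16 + 3 * (1 + w\<^sup>2)\<^sup>2 / w\<^sup>2) / sqrt n
        \<le> eps"
  shows "real n * (ln (1 + w\<^sup>2) / 2) + ln n / 2 - ln 2 \<le> ln (Mstar n eps P)"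
proof -
  define s where "s = sqrt (1 + w\<^sup>2)"
  have s_ge_1: "s \<ge> 1" by (simp add: s_def)
  define T where "T = sqrt n * s ^ n"
  have T_ge_1: "T \<ge> 1" using n_ge_5 s_ge_1 mult_mono[of 1 "sqrt n" 1 "s ^ n"] by (simp add: T_def)
  define M where "M = nat \<lfloor>T\<rfloor>"
  have "1 \<le> \<lfloor>T\<rfloor>" using T_ge_1 by simp
  then have M_bounds: "M \<ge> 1" "real M \<le> T" "T / 2 \<le> real M" unfolding M_def by linarith+
  have "real M * (3 * (1 + w\<^sup>2)\<^sup>2 / (w\<^sup>2 * real n * s ^ n))
      \<le> T * (3 * (1 + w\<^sup>2)\<^sup>2 / (w\<^sup>2 * real n * s ^ n))"
    using M_bounds(2) s_ge_1 by (intro mult_right_mono) auto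
  also have "\<dots> = 3 * (1 + w\<^sup>2)\<^sup>2 / w\<^sup>2 * (sqrt n / real n)"
    using s_ge_1 by (simp add: T_def)
  also have "sqrt n / real n = 1 / sqrt n" by (simp add: sqrt_divide_self_eq inverse_eq_divide)
  also have "3 * (1 + w\<^sup>2)\<^sup>2 / w\<^sup>2 * (1 / sqrt n) = 3 * (1 + w\<^sup>2)\<^sup>2 / w\<^sup>2 / sqrt n" by simp
  finally have competitors: "real M * (3 * (1 + w\<^sup>2)\<^sup>2 / (w\<^sup>2 * real n * s ^ n))
      \<le> 3 * (1 + w\<^sup>2)\<^sup>2 / w\<^sup>2 / sqrt n" .
  obtain k where n_Suc: "n = Suc k" "k \<ge> 4"
    using n_ge_5 by (metis Suc_le_D Suc_le_mono numeral_eq_Suc pred_numeral_simps(3))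
  have "\<exists>x D. is_av_code n M eps P x D"
    unfolding n_Suc(1)
  proof (rule spherical_code_exists[OF n_Suc(2) w_pos P_nonneg M_bounds(1)], unfold n_Suc(1)[symmetric])
    show "Phi (sqrt n * (w - sqrt P) / sqrt (1 + w\<^sup>2 / 2)) + 16 / sqrt n
      + real M * (3 * (1 + w\<^sup>2)\<^sup>2 / (w\<^sup>2 * real n * sqrt (1 + w\<^sup>2) ^ n)) \<le> eps"
      using competitors error unfolding s_def add_divide_distrib by linarith
  qed
  then have "M \<le> Mstar n eps P" using eps_less_1 code_size_le_Mstar by blast
  then have "ln (T / 2) \<le> ln (Mstar n eps P)" using M_bounds T_ge_1 by (intro ln_mono) auto
  moreover have "ln (T / 2) = ln (sqrt n) + real n * ln s - ln 2"
    using n_ge_5 s_ge_1 by (simp add: T_def ln_div ln_mult_pos ln_realpow)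
  ultimately show ?thesis using n_ge_5 by (simp add: s_def ln_sqrt add_pos_nonneg)
qed

lemma ln_one_plus_square_lower:
  fixes a w :: real
  shows "ln (1 + a\<^sup>2) + 2 * a / (1 + a\<^sup>2) * (w - a) - (w - a)\<^sup>2 \<le> ln (1 + w\<^sup>2)"
proof -
  define p where "p = 1 + w\<^sup>2"
  define r where "r = 1 + a\<^sup>2"
  have pos: "p > 0" "r > 0" by (auto simp: p_def r_def add_pos_nonneg)
  have "ln (r / p) \<le> r / p - 1" using pos by (intro ln_le_minus_one) auto
  then have ln_ge: "1 - r / p \<le> ln p - ln r" using pos by (simp add: ln_div)
  have "p * r - (2 * a * w + a\<^sup>2) = (1 - a * w)\<^sup>2 + w\<^sup>2"
    by (simp add: p_def r_def power2_eq_square algebra_simps)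
  then have "2 * a * w + a\<^sup>2 \<le> p * r" by (smt (verit) zero_le_power2)
  then have "- 1 \<le> (1 - (2 * a * w + a\<^sup>2)) / (p * r)" using pos by (simp add: pos_le_divide_eq)
  then have "(w - a)\<^sup>2 * (- 1) \<le> (w - a)\<^sup>2 * ((1 - (2 * a * w + a\<^sup>2)) / (p * r))"
    by (intro mult_left_mono) auto
  also have "\<dots> = (1 - r / p) - 2 * a / r * (w - a)"
  proof -
    have "((1 - r / p) - 2 * a / r * (w - a)) * (p * r) = (p - r) * r - 2 * a * (w - a) * p"
      using pos by (simp add: field_simps)
    also have "\<dots> = (w - a)\<^sup>2 * (1 - (2 * a * w + a\<^sup>2))"
      by (simp add: p_def r_def power2_eq_square algebra_simps)
    finally have "(1 - r / p) - 2 * a / r * (w - a) = (w - a)\<^sup>2 * (1 - (2 * a * w + a\<^sup>2)) / (p * r)"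
      using pos by (subst nonzero_eq_divide_eq) auto
    then show ?thesis by simp
  qed
  finally show ?thesis using ln_ge unfolding p_def r_def by linarith
qed

text \<open>The variable \<open>x\<close> stands for \<open>1 / sqrt n\<close>; the term \<open>c * x\<^sup>2\<close> absorbs the part of the
  error bound that is linear in \<open>x\<close>.\<close>

definition threshold :: "real \<Rightarrow> real \<Rightarrow> real \<Rightarrow> real \<Rightarrow> real" where
  "threshold P q c x = sqrt P + (sqrt (1 + P / 2) * q - c * x) * x"

lemma eventually_threshold_pos:
  assumes "P > 0"
  shows "eventually (\<lambda>x. threshold P q c x > 0) (at_right 0)"
proof -
  have "((threshold P q c) \<longlongrightarrow> threshold P q c 0) (at_right 0)"
    unfolding threshold_def by (intro tendsto_intros)
  moreover have "0 < threshold P q c 0" using assms by (simp add: threshold_def)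
  ultimately show ?thesis by (rule order_tendstoD(1))
qed

definition code_error_bound :: "real \<Rightarrow> real \<Rightarrow> real \<Rightarrow> real \<Rightarrow> real" where
  "code_error_bound P q c x =
    Phi ((sqrt (1 + P / 2) * q - c * x) / sqrt (1 + (threshold P q c x)\<^sup>2 / 2))
    + (16 + 3 * (1 + (threshold P q c x)\<^sup>2)\<^sup>2 / (threshold P q c x)\<^sup>2) * x"

lemma code_error_bound_has_real_derivative_0:
  assumes P_pos: "P > 0"
  shows "(code_error_bound P q c has_real_derivative
    16 + 3 * (1 + P)\<^sup>2 / P - std_normal_density q * ((c + sqrt P * q\<^sup>2 / 2) / sqrt (1 + P / 2))) (at 0)"
proof -
  define L where "L = sqrt (1 + P / 2)"
  have L_props: "L > 0" "L\<^sup>2 = 1 + P / 2" using P_pos by (auto simp: L_def)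
  define w where "w = threshold P q c"
  have w_at_0: "w 0 = sqrt P" "1 + (sqrt P)\<^sup>2 / 2 = L\<^sup>2"
    using P_pos L_props by (auto simp: w_def threshold_def)
  have w_deriv: "(w has_real_derivative L * q) (at 0)"
    unfolding w_def threshold_def L_def[symmetric] by (auto intro!: derivative_eq_intros)
  have denominator: "((\<lambda>x. sqrt (1 + (w x)\<^sup>2 / 2)) has_real_derivative sqrt P * q / 2) (at 0)"
    using L_props(1) by (auto intro!: derivative_eq_intros w_deriv simp: w_at_0)
  have "((\<lambda>x. L * q - c * x) has_real_derivative - c) (at 0)"
    by (auto intro!: derivative_eq_intros)
  from DERIV_divide[OF this denominator]
  have "((\<lambda>x. (L * q - c * x) / sqrt (1 + (w x)\<^sup>2 / 2)) has_real_derivative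
      (- c * L - L * q * (sqrt P * q / 2)) / (L * L)) (at 0)"
    using L_props(1) by (simp add: w_at_0)
  also have "(- c * L - L * q * (sqrt P * q / 2)) / (L * L) = - ((c + sqrt P * q\<^sup>2 / 2) / L)"
    using L_props(1) by (simp add: field_simps power2_eq_square)
  finally have quotient: "((\<lambda>x. (L * q - c * x) / sqrt (1 + (w x)\<^sup>2 / 2)) has_real_derivative
      - ((c + sqrt P * q\<^sup>2 / 2) / L)) (at 0)" .
  have main_term: "((\<lambda>x. Phi ((L * q - c * x) / sqrt (1 + (w x)\<^sup>2 / 2))) has_real_derivative
      std_normal_density q * - ((c + sqrt P * q\<^sup>2 / 2) / L)) (at 0)"
    using L_props(1) by (intro DERIV_chain2[OF _ quotient]) (simp add: w_at_0 Phi_has_real_derivative)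
  have correction: "((\<lambda>x. (16 + 3 * (1 + (w x)\<^sup>2)\<^sup>2 / (w x)\<^sup>2) * x) has_real_derivative
      16 + 3 * (1 + P)\<^sup>2 / P) (at 0)"
    using P_pos by (auto intro!: derivative_eq_intros w_deriv simp: w_at_0)
  show ?thesis
    unfolding code_error_bound_def[abs_def] w_def[symmetric] L_def[symmetric]
    by (rule DERIV_cong[OF DERIV_add[OF main_term correction]]) simp
qed

lemma eventually_code_error_bound_le:
  assumes P_pos: "P > 0" and eps_range: "0 < eps" "eps < 1"
  obtains c where "c \<ge> 0" "eventually (\<lambda>x. code_error_bound P (Phi_inv eps) c x \<le> eps) (at_right 0)"
proof -
  define q where "q = Phi_inv eps"
  define L where "L = sqrt (1 + P / 2)"
  define B where "B = 17 + 3 * (1 + P)\<^sup>2 / P"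
  define c where "c = L * B / std_normal_density q"
  have L_pos: "L > 0" and B_pos: "B > 0" and density_pos: "std_normal_density q > 0"
    using P_pos by (auto simp: L_def B_def normal_density_pos intro!: add_pos_nonneg)
  have "std_normal_density q * (c / L) \<le> std_normal_density q * ((c + sqrt P * q\<^sup>2 / 2) / L)"
    using L_pos P_pos by (intro mult_left_mono divide_right_mono) auto
  moreover have "std_normal_density q * (c / L) = B" using L_pos density_pos by (simp add: c_def)
  ultimately have "16 + 3 * (1 + P)\<^sup>2 / P - std_normal_density q * ((c + sqrt P * q\<^sup>2 / 2) / L) < 0"
    by (simp add: B_def)
  then obtain d where "d > 0"
    and decreasing: "\<And>h. 0 < h \<Longrightarrow> h < d \<Longrightarrow> code_error_bound P q c (0 + h) < code_error_bound P q c 0"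
    using DERIV_neg_dec_right[OF code_error_bound_has_real_derivative_0[OF P_pos, of q c]]
    unfolding L_def by blast
  moreover have "code_error_bound P q c 0 = eps"
    using P_pos eps_range by (simp add: code_error_bound_def threshold_def q_def Phi_Phi_inv)
  ultimately have "eventually (\<lambda>x. code_error_bound P q c x \<le> eps) (at_right 0)"
    unfolding eventually_at_right_field by (auto intro!: exI[of _ d] less_imp_le)
  moreover have "c \<ge> 0" using L_pos B_pos by (simp add: c_def)
  ultimately show thesis unfolding q_def by (intro that)
qed

lemma threshold_rate_ge:
  fixes n :: nat
  assumes P_pos: "P > 0" and c_nonneg: "c \<ge> 0" and n_pos: "n \<ge> 1"
  defines "V \<equiv> P * (P + 2) / (2 * (P + 1)\<^sup>2)"
  shows "real n * (ln (1 + P) / 2) + sqrt (real n * V) * q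
      - (sqrt P / (1 + P) * c + (sqrt (1 + P / 2) * \<bar>q\<bar> + c)\<^sup>2 / 2)
    \<le> real n * (ln (1 + (threshold P q c (1 / sqrt n))\<^sup>2) / 2)"
proof -
  define L where "L = sqrt (1 + P / 2)"
  define x where "x = 1 / sqrt n"
  have x_props: "0 \<le> x" "x \<le> 1" "real n * x\<^sup>2 = 1" "real n * x = sqrt n"
    using n_pos by (auto simp: x_def power_divide real_div_sqrt)
  define w where "w = threshold P q c x"
  define b where "b = L * q - c * x"
  have w_minus: "w - sqrt P = b * x" by (simp add: w_def threshold_def b_def L_def)
  have "V = P * (1 + P / 2) / (1 + P)\<^sup>2" using P_pos by (simp add: V_def divide_simps add.commute)
  then have sqrt_V: "sqrt P * L / (1 + P) = sqrt V"
    using P_pos by (simp add: L_def real_sqrt_divide real_sqrt_mult)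
  have "\<bar>b\<bar> \<le> L * \<bar>q\<bar> + c"
  proof -
    have "\<bar>b\<bar> \<le> \<bar>L * q\<bar> + \<bar>c * x\<bar>" unfolding b_def by (rule abs_triangle_ineq4)
    also have "\<bar>c * x\<bar> \<le> c" using x_props c_nonneg by (simp add: mult_left_le)
    finally show ?thesis using P_pos by (simp add: abs_mult L_def)
  qed
  then have b_square: "b\<^sup>2 \<le> (L * \<bar>q\<bar> + c)\<^sup>2" by (metis abs_ge_zero power2_abs power_mono)
  have "ln (1 + P) + 2 * sqrt P / (1 + P) * (b * x) - (b * x)\<^sup>2 \<le> ln (1 + w\<^sup>2)"
    using ln_one_plus_square_lower[of "sqrt P" w] P_pos unfolding w_minus by simp
  then have "real n * ((ln (1 + P) + 2 * sqrt P / (1 + P) * (b * x) - (b * x)\<^sup>2) / 2)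
      \<le> real n * (ln (1 + w\<^sup>2) / 2)"
    by (intro mult_left_mono divide_right_mono) auto
  also have "real n * ((ln (1 + P) + 2 * sqrt P / (1 + P) * (b * x) - (b * x)\<^sup>2) / 2)
      = real n * (ln (1 + P) / 2) + sqrt P / (1 + P) * b * (real n * x) - b\<^sup>2 * (real n * x\<^sup>2) / 2"
    by (simp add: power_mult_distrib field_simps)
  also have "\<dots> = real n * (ln (1 + P) / 2) + sqrt n * sqrt V * q - sqrt P / (1 + P) * c - b\<^sup>2 / 2"
  proof -
    have "sqrt P / (1 + P) * b * sqrt n
        = sqrt n * (sqrt P * L / (1 + P)) * q - sqrt P / (1 + P) * c * (sqrt n * x)"
      by (simp add: b_def algebra_simps)
    moreover have "sqrt n * x = 1" using n_pos by (simp add: x_def)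
    ultimately show ?thesis unfolding x_props(3,4) sqrt_V by simp
  qed
  finally show ?thesis using b_square unfolding w_def L_def x_def real_sqrt_mult by linarith
qed

lemma eventually_ln_Mstar_ge:
  assumes P_pos: "P > 0" and eps_range: "0 < eps" "eps < 1"
  obtains K where "eventually (\<lambda>n. real n * (ln (1 + P) / 2)
    + sqrt (real n * (P * (P + 2) / (2 * (P + 1)\<^sup>2))) * Phi_inv eps + ln n / 2 - K \<le> ln
      (Mstar n eps P)) sequentially"
proof -
  define q where "q = Phi_inv eps"
  obtain c where c_props: "c \<ge> 0" "eventually (\<lambda>x. code_error_bound P q c x \<le> eps) (at_right 0)"
    using eventually_code_error_bound_le[OF P_pos eps_range] unfolding q_def by blast
  define w where "w n = threshold P q c (1 / sqrt n)" for n :: nat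
  have inverse_sqrt_lim: "filterlim (\<lambda>n. 1 / sqrt (real n)) (at_right 0) sequentially" by real_asymp
  have w_pos: "eventually (\<lambda>n. w n > 0) sequentially"
    unfolding w_def
    by (rule eventually_compose_filterlim[OF eventually_threshold_pos[OF P_pos] inverse_sqrt_lim])
  have error: "eventually (\<lambda>n. code_error_bound P q c (1 / sqrt (real n)) \<le> eps) sequentially"
    by (rule eventually_compose_filterlim[OF c_props(2) inverse_sqrt_lim])
  have "eventually (\<lambda>n. real n * (ln (1 + (w n)\<^sup>2) / 2) + ln n / 2 - ln 2
      \<le> ln (Mstar n eps P)) sequentially"
    using w_pos error eventually_ge_at_top[of 5]
  proof eventually_elim
    case (elim n)
    have "sqrt n * (w n - sqrt P) = sqrt (1 + P / 2) * q - c * (1 / sqrt n)"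
      using elim(3) by (simp add: w_def threshold_def)
    then show ?case
      using elim P_pos eps_range by (intro ln_Mstar_ge) (auto simp: code_error_bound_def w_def)
  qed
  then show thesis
  proof (intro that, elim eventually_elim2[OF _ eventually_ge_at_top[of 1]])
    fix n :: nat assume "real n * (ln (1 + (w n)\<^sup>2) / 2) + ln n / 2 - ln 2 \<le> ln (Mstar n eps P)" "1 \<le> n"
    then show "real n * (ln (1 + P) / 2) + sqrt (real n * (P * (P + 2) / (2 * (P + 1)\<^sup>2)))
        * Phi_inv eps + ln n / 2
        - (sqrt P / (1 + P) * c + (sqrt (1 + P / 2) * \<bar>q\<bar> + c)\<^sup>2 / 2 + ln 2) \<le> ln (Mstar n eps P)"
      using threshold_rate_ge[OF P_pos c_props(1), of n q] unfolding w_def q_def by linarith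
  qed
qed

lemma eventually_le_imp_bounded_above:
  fixes f :: "nat \<Rightarrow> real"
  assumes "eventually (\<lambda>n. f n \<le> K) sequentially"
  obtains K' where "\<And>n. f n \<le> K'"
proof -
  obtain N where N_bound: "\<And>n. n \<ge> N \<Longrightarrow> f n \<le> K"
    using assms by (auto simp: eventually_sequentially)
  show thesis
  proof (rule that)
    fix n
    show "f n \<le> Max (insert K (f ` {..<N}))"
      using N_bound[of n] by (cases "n < N") (auto simp: Max_ge_iff intro!: bexI[of _ n])
  qed
qed

theorem theorem1:
  fixes b eps P :: real
  assumes "b > 1" and "0 < eps" and "eps < 1" and "0 < P"
  shows "\<exists>c::real. \<forall>n::nat. n \<ge> 1 \<longrightarrow>
           log b (real (Mstar n eps P))
             \<ge> real n * cap b P + sqrt (real n * disp b P) * Phi_inv eps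
                + 1/2 * log b (real n) + c"
proof -
  define V where "V = P * (P + 2) / (2 * (P + 1)\<^sup>2)"
  define R where "R n = real n * (ln (1 + P) / 2) + sqrt (real n * V) * Phi_inv eps + ln n / 2" for n :: nat
  obtain K where "eventually (\<lambda>n. R n - ln (Mstar n eps P) \<le> K) sequentially"
    using eventually_ln_Mstar_ge[OF assms(4,2,3)] unfolding R_def V_def by (auto simp: algebra_simps)
  then obtain K' where bounded: "\<And>n. R n - ln (Mstar n eps P) \<le> K'"
    by (rule eventually_le_imp_bounded_above) blast
  have ln_b: "ln b > 0" using assms by simp
  show ?thesis
  proof (intro exI[of _ "- K' / ln b"] allI impI)
    fix n :: nat
    have "sqrt (real n * disp b P) = sqrt (real n * V) / ln b"
      using ln_b by (simp add: disp_def V_def log_def power_divide real_sqrt_divide real_sqrt_mult)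
    then have "real n * cap b P + sqrt (real n * disp b P) * Phi_inv eps + 1/2 * log b (real n)
        + - K' / ln b
        = (R n - K') / ln b"
      by (simp add: R_def cap_def log_def add_divide_distrib diff_divide_distrib)
    also have "\<dots> \<le> ln (Mstar n eps P) / ln b"
      using bounded[of n] ln_b by (intro divide_right_mono) auto
    finally show "log b (real (Mstar n eps P))
      \<ge> real n * cap b P + sqrt (real n * disp b P) * Phi_inv eps + 1/2 * log b (real n) + - K' / ln b"
      by (simp add: log_def)
  qed
qed

end
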